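(* Let $f\in N$ and let $a\in[0,1)$. Then $f\in N^+$ if and only if the set of functions \[ \{\log^+|(f\circ\psi)^*| : \psi\in\mathcal{S}_a\} \] is uniformly integrable on $\mathbb{T}$.
   Context: $\mathbb{D}$ is the open unit disk in $\mathbb{C}$ and $\mathbb{T}$ is the unit circle, equipped with Lebesgue (arc-length) measure. $\log^+ x=\max(\log x,0)$, with $\log^+0=0$. $\mathcal{S}$ denotes the set of holomorphic functions $\phi:\mathbb{D}\to\mathbb{D}$, and for $a\in[0,1)$, $\mathcal{S}_a:=\{\psi\in\mathcal{S}:|\psi(0)|\le a\}$. A holomorphic function $g:\mathbb{D}\to\mathbb{C}$ is called outer if it has the form \[ g(z)=c\exp\Bigl(\int_{\mathbb{T}} \frac{e^{i\theta}+z}{e^{i\theta}-z}\log\rho(e^{i\theta})\,\frac{d\theta}{2\pi}\Bigr)\quad(z\in\mathbb{D}), \] where $c$ is a unimodular constant and $\rho:\mathbb{T}\to\mathbb{R}^+$ is a function such that $\log\rho\in L^1(\mathbb{T})$. The Nevanlinna class $N$ consists of those functions of the form $f=f_1/f_2$, where $f_1,f_2$ are bounded and holomorphic on $\mathbb{D}$ and $f_2$ has no zeros. The Smirnov class $N^+$ is the subclass of $N$ consisting of those $f=f_1/f_2$, where $f_1,f_2$ are bounded and holomorphic on $\mathbb{D}$ and $f_2$ is outer. For $g\in N$, $g^*(e^{i\theta}):=\lim_{r\to1^-}g(re^{i\theta})$ denotes the radial boundary limit, which exists a.e. on $\mathbb{T}$. If $f\in N$ and $\psi\in\mathcal{S}$,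 then $f\circ\psi\in N$, so $(f\circ\psi)^*$ exists a.e. on $\mathbb{T}$. A family $\mathcal{G}$ of measurable complex-valued functions on a measure space $(X,\mu)$ is uniformly integrable if $\sup_{g\in\mathcal{G}}\int_{\{|g|\ge t\}}|g|\,d\mu\to0$ as $t\to\infty$. *)

theory Defs
  imports "HOL-Complex_Analysis.Complex_Analysis"
begin

abbreviation unit_disk :: "complex set" where
  "unit_disk \<equiv> ball 0 1"

abbreviation unit_circle :: "complex set" where
  "unit_circle \<equiv> sphere 0 1"

text \<open>
  The unit circle with unnormalised arc length (total mass $2\pi$). The completion makes
  the measurable sets the Lebesgue measurable ones rather than just the Borel ones.
\<close>

definition arc_length :: "complex measure" where
  "arc_length =
     completion (distr (restrict_space lborel {0..<2*pi}) (restrict_space borel unit_circle) cis)"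

lemma measurable_cis_arc:
  "cis \<in> restrict_space lborel {0..<2*pi} \<rightarrow>\<^sub>M restrict_space borel unit_circle"
proof -
  have "continuous_on UNIV cis"
    by (intro continuous_intros)
  then have "cis \<in> borel \<rightarrow>\<^sub>M borel"
    by (rule borel_measurable_continuous_onI)
  then show ?thesis
    by (intro measurable_restrict_space2 measurable_restrict_space1) auto
qed

lemma space_arc_length: "space arc_length = unit_circle"
  by (simp add: arc_length_def space_restrict_space)

lemma emeasure_arc_length_space: "emeasure arc_length unit_circle = ennreal (2 * pi)"
proof -
  let ?L = "restrict_space lborel {0..<2*pi}"
  let ?T = "restrict_space borel unit_circle"
  have T: "unit_circle \<in> sets ?T"
    by (metis sets.top space_restrict_space space_borel inf_top_right)
  have "emeasure arc_length unit_circle = emeasure (distr ?L ?T cis) unit_circle"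
    using T by (simp add: arc_length_def emeasure_completion)
  also have "\<dots> = emeasure ?L (cis -` unit_circle \<inter> space ?L)"
    by (rule emeasure_distr[OF measurable_cis_arc T])
  also have "cis -` unit_circle \<inter> space ?L = {0..<2*pi}"
    by (auto simp: space_restrict_space)
  also have "emeasure ?L {0..<2*pi} = ennreal (2 * pi)"
    by (simp add: emeasure_restrict_space)
  finally show ?thesis .
qed

definition log_plus :: "real \<Rightarrow> real" where
  "log_plus x = (if x = 0 then 0 else max (ln x) 0)"

text \<open>
  Functions on the disk are total functions of which only the values on \<^term>\<open>unit_disk\<close>
  matter; none of the following notions depends on the values elsewhere.
\<close>

definition schur_class :: "(complex \<Rightarrow> complex) set" where
  "schur_class = {\<phi>. \<phi> holomorphic_on unit_disk \<and> \<phi> ` unit_disk \<subseteq> unit_disk}"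

definition schur_class_le :: "real \<Rightarrow> (complex \<Rightarrow> complex) set" where
  "schur_class_le a = {\<psi> \<in> schur_class. cmod (\<psi> 0) \<le> a}"

definition outer :: "(complex \<Rightarrow> complex) \<Rightarrow> bool" where
  "outer g \<longleftrightarrow>
     g holomorphic_on unit_disk \<and>
     (\<exists>c (\<rho> :: complex \<Rightarrow> real).
        cmod c = 1 \<and>
        (\<forall>\<zeta>\<in>unit_circle. \<rho> \<zeta> > 0) \<and>
        integrable arc_length (\<lambda>\<zeta>. ln (\<rho> \<zeta>)) \<and>
        (\<forall>z\<in>unit_disk.
           g z = c * exp ((\<integral>\<zeta>. (\<zeta> + z) / (\<zeta> - z) * complex_of_real (ln (\<rho> \<zeta>)) \<partial>arc_length)
                          / (2 * pi))))"

definition bounded_holomorphic :: "(complex \<Rightarrow> complex) \<Rightarrow> bool" where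
  "bounded_holomorphic g \<longleftrightarrow> g holomorphic_on unit_disk \<and> bounded (g ` unit_disk)"

definition nevanlinna :: "(complex \<Rightarrow> complex) set" where
  "nevanlinna =
     {f. \<exists>f1 f2. bounded_holomorphic f1 \<and> bounded_holomorphic f2 \<and>
           (\<forall>z\<in>unit_disk. f2 z \<noteq> 0) \<and> (\<forall>z\<in>unit_disk. f z = f1 z / f2 z)}"

definition smirnov :: "(complex \<Rightarrow> complex) set" where
  "smirnov =
     {f \<in> nevanlinna. \<exists>f1 f2. bounded_holomorphic f1 \<and> bounded_holomorphic f2 \<and>
           outer f2 \<and> (\<forall>z\<in>unit_disk. f z = f1 z / f2 z)}"

text \<open>Where the limit does not exist, the value is a fixed unspecified number.\<close>

definition radial_limit :: "(complex \<Rightarrow> complex) \<Rightarrow> complex \<Rightarrow> complex" where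
  "radial_limit g \<zeta> = Lim (at_left 1) (\<lambda>r::real. g (complex_of_real r * \<zeta>))"

text \<open>
  The integrals and their supremum are taken in \<^typ>\<open>ennreal\<close>, so that members of the family
  that are not integrable, or a family with unbounded integrals, count as infinite.
\<close>

definition uniformly_integrable ::
    "'a measure \<Rightarrow> ('a \<Rightarrow> 'b::real_normed_vector) set \<Rightarrow> bool" where
  "uniformly_integrable M G \<longleftrightarrow>
     (\<forall>g\<in>G. g \<in> borel_measurable M) \<and>
     ((\<lambda>t::real. SUP g\<in>G. \<integral>\<^sup>+x\<in>{x \<in> space M. norm (g x) \<ge> t}. ennreal (norm (g x)) \<partial>M)
        \<longlongrightarrow> 0) at_top"

end

theory Submission
  imports Defs "HOL-Real_Asymp.Real_Asymp"
begin

text \<open>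
  For integrable real \<open>k\<close> on the circle let \<open>H[k]\<close> be its Herglotz transform, the holomorphic function
  on the disk whose real part is the Poisson integral of \<open>k\<close>. Both directions rest on one description
  of the Smirnov class: \<open>f \<in> N\<close> belongs to \<open>N\<^sup>+\<close> iff \<open>|f| \<le> exp (Re H[k])\<close> on the disk for some integrable
  \<open>k \<ge> 0\<close>. Indeed, if \<open>f = f1/f2\<close> with \<open>|f1| \<le> B\<close> and \<open>f2\<close> outer with boundary modulus \<open>\<rho>\<close>, then
  \<open>k = log B - log \<rho>\<close> gives such a bound, hence its positive part does; conversely
  \<open>f = (f exp (-H[k])) / exp (-H[k])\<close> is a quotient of bounded functions with outer denominator.

  If \<open>f\<close> has such a majorant, then \<open>log\<^sup>+ |f| \<le> n + Re H[(k - n)\<^sup>+]\<close> for each \<open>n \<ge> 0\<close>. The last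
  term is a nonnegative harmonic function, and so is its composition with a Schur function \<open>\<psi>\<close>. If \<open>|\<psi>(0)| \<le> a\<close>, the
  mean value property and Harnack's inequality bound its integral over every circle \<open>|z| = r\<close> by
  \<open>(1 + a)/(1 - a)\<close> times the integral of \<open>(k - n)\<^sup>+\<close>, which is small for large \<open>n\<close> and does not involve
  \<open>\<psi>\<close>. Fatou's lemma transfers this bound to the radial limits (\<open>nn_integral_log_plus_excess_le\<close>).
  Where a radial limit fails to exist, \<open>radial_limit\<close> takes one fixed value, and truncation levels
  \<open>n\<close> above the corresponding value of \<open>log\<^sup>+\<close> ignore such points.

  Conversely, it suffices to consider the dilations \<open>\<psi>(z) = r z\<close>; they fix the origin, hence lie in the class
  for every \<open>a \<ge> 0\<close>. Bounded holomorphic functions have dilations that are Cauchy in \<open>L\<^sup>2\<close> as \<open>r\<close> tends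
  to 1 (Parseval), so along some sequence \<open>r\<^sub>j\<close> the dilations of numerator and denominator of \<open>f\<close>
  converge almost everywhere; the limit of the denominator is almost everywhere nonzero because the
  means of \<open>log |f2|\<close> are constant (\<open>AE_lim_dilations_nonzero\<close>). Hence \<open>log\<^sup>+ |f(r\<^sub>j \<zeta>)|\<close> converges
  almost everywhere to some \<open>k\<close>, and by uniform integrability also in \<open>L\<^sup>1\<close> (\<open>vitali_convergence\<close>).
  For a function holomorphic across the circle, \<open>|F| \<le> exp u\<close> on the circle implies
  \<open>|F| \<le> exp (Re H[u])\<close> inside (\<open>cmod_le_exp_herglotz\<close>); applied to the dilations of \<open>f\<close>, this yields
  \<open>|f| \<le> exp (Re H[k])\<close> in the limit.
\<close>

section \<open>Integration over the unit circle\<close>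

lemma finite_measure_arc_length: "finite_measure arc_length"
  by (rule finite_measureI) (simp add: space_arc_length emeasure_arc_length_space)

interpretation arc: finite_measure arc_length
  by (rule finite_measure_arc_length)

lemma measure_arc_length_space [simp]: "measure arc_length (space arc_length) = 2 * pi"
  by (simp add: space_arc_length measure_def emeasure_arc_length_space)

lemma borel_measurable_arc_length:
  assumes "g \<in> borel_measurable (restrict_space borel unit_circle)"
  shows "g \<in> borel_measurable arc_length"
  unfolding arc_length_def using assms by (intro measurable_completion) simp

lemma borel_measurable_arc_length_continuous:
  assumes "continuous_on unit_circle g"
  shows "g \<in> borel_measurable arc_length"
  by (intro borel_measurable_arc_length borel_measurable_continuous_on_restrict assms)

lemma integrable_arc_length_bounded:
  fixes g :: "complex \<Rightarrow> 'a::{banach,second_countable_topology}"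
  assumes "g \<in> borel_measurable arc_length"
    and "\<And>\<zeta>. \<zeta> \<in> unit_circle \<Longrightarrow> norm (g \<zeta>) \<le> B"
  shows "integrable arc_length g"
  by (rule arc.integrable_const_bound[of _ B]) (use assms in \<open>auto simp: space_arc_length\<close>)

lemma integrable_arc_length_continuous:
  fixes g :: "complex \<Rightarrow> 'a::{banach,second_countable_topology}"
  assumes "continuous_on unit_circle g"
  shows "integrable arc_length g"
proof -
  have "bounded (g ` unit_circle)"
    by (intro compact_imp_bounded compact_continuous_image assms) auto
  then obtain B where "\<And>\<zeta>. \<zeta> \<in> unit_circle \<Longrightarrow> norm (g \<zeta>) \<le> B"
    unfolding bounded_iff by blast
  then show ?thesis
    by (intro integrable_arc_length_bounded borel_measurable_arc_length_continuous assms)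
qed

text \<open>
  For continuous integrands neither the completion nor the missing endpoint of the
  parametrisation matters, so the integral becomes an ordinary one over \<open>{0..2*pi}\<close>, to which
  the fundamental theorem of calculus applies.
\<close>

lemma integral_arc_length_eq:
  fixes g :: "complex \<Rightarrow> 'a::euclidean_space"
  assumes "continuous_on unit_circle g"
  shows "(\<integral>\<zeta>. g \<zeta> \<partial>arc_length) = integral {0..2*pi} (\<lambda>t. g (cis t))"
proof -
  let ?L = "restrict_space lborel {0..<2*pi}"
  let ?T = "restrict_space borel unit_circle"
  have g: "g \<in> borel_measurable ?T"
    by (intro borel_measurable_continuous_on_restrict assms)
  have c: "continuous_on S (\<lambda>t. g (cis t))" for S
    by (intro continuous_on_compose2[OF assms] continuous_intros) auto
  have "(\<integral>\<zeta>. g \<zeta> \<partial>arc_length) = (\<integral>\<zeta>. g \<zeta> \<partial>distr ?L ?T cis)"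
    unfolding arc_length_def using g by (intro integral_completion) simp
  also have "\<dots> = (\<integral>t. g (cis t) \<partial>?L)"
    by (intro integral_distr measurable_cis_arc g)
  also have "\<dots> = (LINT t:{0..<2*pi}|lborel. g (cis t))"
    unfolding set_lebesgue_integral_def by (intro integral_restrict_space) auto
  also have "\<dots> = (LINT t:{0..2*pi}|lborel. g (cis t))"
  proof -
    have "AE t in lborel. t \<noteq> 2*pi" by (rule AE_lborel_singleton)
    then show ?thesis
      unfolding set_lebesgue_integral_def
      by (intro integral_cong_AE borel_measurable_scaleR borel_measurable_indicator
            borel_measurable_continuous_onI c)
         (auto elim!: AE_mp simp: indicator_def borel_measurable_continuous_onI c)
  qed
  also have "\<dots> = integral {0..2*pi} (\<lambda>t. g (cis t))"
    by (intro set_borel_integral_eq_integral borel_integrable_atLeastAtMost' c)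
  finally show ?thesis .
qed

lemma integral_arc_length_power:
  assumes "n > 0"
  shows "(\<integral>\<zeta>. \<zeta> ^ n \<partial>arc_length) = 0"
proof -
  have "((\<lambda>t. cis t ^ n) has_integral
      (cis (2*pi) ^ n / (\<i> * n) - cis 0 ^ n / (\<i> * n))) {0..2*pi}"
    using assms
    by (intro fundamental_theorem_of_calculus)
       (auto intro!: derivative_eq_intros has_vector_derivative_real_field simp: cis_conv_exp simp flip: exp_of_nat_mult)
  then show ?thesis
    by (subst integral_arc_length_eq) (auto intro!: continuous_intros simp: integral_unique)
qed

text \<open>
  Orthogonality of the monomials: on the circle \<open>cnj \<zeta>\<close> is the inverse of \<open>\<zeta>\<close>, so only one power
  of \<open>\<zeta>\<close> or of its conjugate is left.
\<close>

lemma integral_arc_length_power_cnj: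
  "(\<integral>\<zeta>. \<zeta> ^ m * cnj \<zeta> ^ n \<partial>arc_length) = (if m = n then 2 * pi else 0)"
proof -
  have unit: "cnj \<zeta> * \<zeta> = 1" "\<zeta> * cnj \<zeta> = 1" if "\<zeta> \<in> space arc_length" for \<zeta>
    using that by (auto simp: space_arc_length complex_norm_square[symmetric] mult.commute)
  consider "m = n" | k where "m = n + k" "k > 0" | k where "n = m + k" "k > 0"
    by (metis add.commute less_imp_add_positive nat_neq_iff)
  then show ?thesis
  proof cases
    case 1
    have "(\<integral>\<zeta>. \<zeta> ^ m * cnj \<zeta> ^ n \<partial>arc_length) = (\<integral>\<zeta>. 1 \<partial>arc_length)"
      by (intro Bochner_Integration.integral_cong) (simp_all add: unit \<open>m = n\<close> flip: power_mult_distrib)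
    then show ?thesis using 1 by (simp add: scaleR_conv_of_real)
  next
    case (2 k)
    have "(\<integral>\<zeta>. \<zeta> ^ m * cnj \<zeta> ^ n \<partial>arc_length) = (\<integral>\<zeta>. \<zeta> ^ k \<partial>arc_length)"
      by (intro Bochner_Integration.integral_cong)
         (simp_all add: unit 2 power_add mult.assoc mult.left_commute[of _ "_ ^ k"] flip: power_mult_distrib)
    then show ?thesis using 2 by (simp add: integral_arc_length_power)
  next
    case (3 k)
    have "(\<integral>\<zeta>. \<zeta> ^ m * cnj \<zeta> ^ n \<partial>arc_length) = (\<integral>\<zeta>. cnj (\<zeta> ^ k) \<partial>arc_length)"
      by (intro Bochner_Integration.integral_cong)
         (simp_all add: unit 3 power_add flip: power_mult_distrib mult.assoc)
    also have "\<dots> = 0"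
      using 3 by (subst Bochner_Integration.integral_cnj) (simp add: integral_arc_length_power)
    finally show ?thesis using 3 by simp
  qed
qed

section \<open>Power series on the unit circle\<close>

text \<open>
  The function \<open>e\<close> will be the identity for power series in \<open>\<zeta>\<close>, and conjugation for the
  expansion of the Herglotz kernel. All terms are dominated by \<open>|c n| |h|\<close>, so sum and integral
  may be exchanged.
\<close>

lemma sums_integral_arc_length:
  fixes e h :: "complex \<Rightarrow> complex"
  assumes h: "integrable arc_length h"
    and e: "e \<in> borel_measurable arc_length"
    and e1: "\<And>\<zeta>. \<zeta> \<in> unit_circle \<Longrightarrow> cmod (e \<zeta>) = 1"
    and c: "summable (\<lambda>n. cmod (c n))"
  shows "(\<lambda>n. c n * (\<integral>\<zeta>. e \<zeta> ^ n * h \<zeta> \<partial>arc_length)) sums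
           (\<integral>\<zeta>. (\<Sum>n. c n * e \<zeta> ^ n) * h \<zeta> \<partial>arc_length)"
proof -
  have [measurable]: "h \<in> borel_measurable arc_length" "e \<in> borel_measurable arc_length"
    using h e by auto
  have eh: "integrable arc_length (\<lambda>\<zeta>. e \<zeta> ^ n * h \<zeta>)" for n
    by (rule Bochner_Integration.integrable_bound[OF h])
       (auto simp: norm_mult norm_power e1 space_arc_length)
  have nrm: "cmod (c n * (e \<zeta> ^ n * h \<zeta>)) = cmod (c n) * cmod (h \<zeta>)" if "\<zeta> \<in> unit_circle" for n \<zeta>
    using that by (simp add: norm_mult norm_power e1)
  have "(\<lambda>n. \<integral>\<zeta>. c n * (e \<zeta> ^ n * h \<zeta>) \<partial>arc_length) sums
          (\<integral>\<zeta>. (\<Sum>n. c n * (e \<zeta> ^ n * h \<zeta>)) \<partial>arc_length)"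
  proof (rule sums_integral)
    show "integrable arc_length (\<lambda>\<zeta>. c n * (e \<zeta> ^ n * h \<zeta>))" for n
      using eh by simp
    show "AE \<zeta> in arc_length. summable (\<lambda>n. cmod (c n * (e \<zeta> ^ n * h \<zeta>)))"
      by (rule AE_I2) (simp add: space_arc_length nrm summable_mult2 c)
    have "(\<integral>\<zeta>. cmod (c n * (e \<zeta> ^ n * h \<zeta>)) \<partial>arc_length) =
            cmod (c n) * (\<integral>\<zeta>. cmod (h \<zeta>) \<partial>arc_length)" for n
      by (subst integral_mult_right_zero[symmetric], intro Bochner_Integration.integral_cong)
         (simp_all add: space_arc_length nrm)
    then show "summable (\<lambda>n. \<integral>\<zeta>. cmod (c n * (e \<zeta> ^ n * h \<zeta>)) \<partial>arc_length)"
      by (simp add: summable_mult2 c)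
  qed
  also have "(\<integral>\<zeta>. (\<Sum>n. c n * (e \<zeta> ^ n * h \<zeta>)) \<partial>arc_length) =
               (\<integral>\<zeta>. (\<Sum>n. c n * e \<zeta> ^ n) * h \<zeta> \<partial>arc_length)"
  proof (intro Bochner_Integration.integral_cong refl)
    fix \<zeta> assume "\<zeta> \<in> space arc_length"
    then have "summable (\<lambda>n. c n * e \<zeta> ^ n)"
      by (intro summable_norm_cancel[OF summable_comparison_test'[OF c, of 0]])
         (simp add: space_arc_length norm_mult norm_power e1)
    then show "(\<Sum>n. c n * (e \<zeta> ^ n * h \<zeta>)) = (\<Sum>n. c n * e \<zeta> ^ n) * h \<zeta>"
      by (simp add: suminf_mult2 mult.assoc)
  qed
  finally show ?thesis by simp
qed

lemma measurable_id_cnj_arc_length [measurable]: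
  "(\<lambda>\<zeta>. \<zeta>) \<in> borel_measurable arc_length" "cnj \<in> borel_measurable arc_length"
  by (intro borel_measurable_arc_length_continuous continuous_intros)+

lemma power_series_measurable_arc_length [measurable]:
  fixes c :: "nat \<Rightarrow> complex"
  shows "(\<lambda>\<zeta>. \<Sum>n. c n * \<zeta> ^ n) \<in> borel_measurable arc_length"
  by measurable

lemma power_series_integrable_arc_length:
  fixes c :: "nat \<Rightarrow> complex"
  assumes c: "summable (\<lambda>n. cmod (c n))"
  shows "integrable arc_length (\<lambda>\<zeta>. \<Sum>n. c n * \<zeta> ^ n)"
proof (rule integrable_arc_length_bounded)
  fix \<zeta> :: complex assume "\<zeta> \<in> unit_circle"
  then have *: "cmod (c n * \<zeta> ^ n) = cmod (c n)" for n
    by (simp add: norm_mult norm_power)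
  show "cmod (\<Sum>n. c n * \<zeta> ^ n) \<le> (\<Sum>n. cmod (c n))"
    using summable_norm[of "\<lambda>n. c n * \<zeta> ^ n"] c by (simp add: *)
qed measurable

lemma fourier_coefficient_power_series:
  fixes c :: "nat \<Rightarrow> complex"
  assumes c: "summable (\<lambda>n. cmod (c n))"
  shows "(\<integral>\<zeta>. (\<Sum>n. c n * \<zeta> ^ n) * cnj \<zeta> ^ m \<partial>arc_length) = 2 * pi * c m"
proof -
  have "(\<lambda>n. c n * (\<integral>\<zeta>. \<zeta> ^ n * cnj \<zeta> ^ m \<partial>arc_length)) sums
          (\<integral>\<zeta>. (\<Sum>n. c n * \<zeta> ^ n) * cnj \<zeta> ^ m \<partial>arc_length)"
    using c by (intro sums_integral_arc_length integrable_arc_length_continuous continuous_intros) auto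
  moreover have "(\<lambda>n. c n * (\<integral>\<zeta>. \<zeta> ^ n * cnj \<zeta> ^ m \<partial>arc_length)) sums (c m * (2 * pi))"
    unfolding integral_arc_length_power_cnj
    using sums_single[of m "\<lambda>n. c n * (2 * pi)"] by (simp add: if_distrib cong: if_cong)
  ultimately show ?thesis
    by (simp add: sums_unique2 mult.commute)
qed

lemma parseval_power_series:
  fixes c :: "nat \<Rightarrow> complex"
  assumes c: "summable (\<lambda>n. cmod (c n))"
  shows "(\<lambda>n. 2 * pi * (cmod (c n))\<^sup>2) sums (\<integral>\<zeta>. (cmod (\<Sum>n. c n * \<zeta> ^ n))\<^sup>2 \<partial>arc_length)"
proof -
  let ?G = "\<lambda>\<zeta>. \<Sum>n. c n * \<zeta> ^ n"
  have "(\<lambda>n. c n * (\<integral>\<zeta>. \<zeta> ^ n * cnj (?G \<zeta>) \<partial>arc_length)) sums (\<integral>\<zeta>. ?G \<zeta> * cnj (?G \<zeta>) \<partial>arc_length)"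
    using c by (intro sums_integral_arc_length) (auto intro: power_series_integrable_arc_length)
  also have "(\<lambda>n. c n * (\<integral>\<zeta>. \<zeta> ^ n * cnj (?G \<zeta>) \<partial>arc_length)) =
      (\<lambda>n. complex_of_real (2 * pi * (cmod (c n))\<^sup>2))"
  proof
    fix n
    have "(\<integral>\<zeta>. \<zeta> ^ n * cnj (?G \<zeta>) \<partial>arc_length) = cnj (\<integral>\<zeta>. ?G \<zeta> * cnj \<zeta> ^ n \<partial>arc_length)"
      by (subst Bochner_Integration.integral_cnj[symmetric]) (simp add: mult.commute)
    also have "\<dots> = 2 * pi * cnj (c n)"
      by (simp only: fourier_coefficient_power_series[OF c]) simp
    finally show "c n * (\<integral>\<zeta>. \<zeta> ^ n * cnj (?G \<zeta>) \<partial>arc_length) = complex_of_real (2 * pi * (cmod (c n))\<^sup>2)"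
      by (simp add: complex_norm_square mult_ac flip: of_real_power)
  qed
  also have "(\<integral>\<zeta>. ?G \<zeta> * cnj (?G \<zeta>) \<partial>arc_length) =
      complex_of_real (\<integral>\<zeta>. (cmod (?G \<zeta>))\<^sup>2 \<partial>arc_length)"
    by (subst integral_complex_of_real[symmetric]) (simp only: complex_norm_square)
  finally show ?thesis
    by (simp only: sums_of_real_iff)
qed

text \<open>
  Taylor coefficients, with absolute convergence on smaller disks; this makes the lemmas above
  applicable to the function \<open>\<zeta> \<mapsto> g (r \<zeta>)\<close>, whose coefficients are \<open>a n * r ^ n\<close>.
\<close>

lemma power_series_of_dilation:
  fixes g :: "complex \<Rightarrow> complex"
  assumes g: "g holomorphic_on ball 0 R"
  obtains a :: "nat \<Rightarrow> complex"
  where "\<And>z. cmod z < R \<Longrightarrow> (\<lambda>n. a n * z ^ n) sums g z"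
    and "\<And>r. 0 \<le> r \<Longrightarrow> r < R \<Longrightarrow> summable (\<lambda>n. cmod (a n * of_real r ^ n))"
proof
  let ?a = "\<lambda>n. (deriv ^^ n) g 0 / fact n"
  show *: "(\<lambda>n. ?a n * z ^ n) sums g z" if "cmod z < R" for z
    using holomorphic_power_series[OF g, of z] that by simp
  show "summable (\<lambda>n. cmod (?a n * of_real r ^ n))" if "0 \<le> r" "r < R" for r
  proof -
    have "summable (\<lambda>n. ?a n * of_real ((r + R) / 2) ^ n)"
      using that by (intro sums_summable[OF *]) (simp only: norm_of_real, simp)
    then show ?thesis
      by (rule powser_insidea) (use that in \<open>simp only: norm_of_real, simp\<close>)
  qed
qed

lemma mean_value_arc_length:
  fixes g :: "complex \<Rightarrow> complex"
  assumes g: "g holomorphic_on ball 0 R" and "1 < R"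
  shows "(\<integral>\<zeta>. g \<zeta> \<partial>arc_length) = 2 * pi * g 0"
proof -
  obtain a where a: "\<And>z. cmod z < R \<Longrightarrow> (\<lambda>n. a n * z ^ n) sums g z"
    and s: "\<And>r. 0 \<le> r \<Longrightarrow> r < R \<Longrightarrow> summable (\<lambda>n. cmod (a n * of_real r ^ n))"
    using power_series_of_dilation[OF g] by blast
  have "(\<integral>\<zeta>. g \<zeta> \<partial>arc_length) = (\<integral>\<zeta>. (\<Sum>n. a n * \<zeta> ^ n) * cnj \<zeta> ^ 0 \<partial>arc_length)"
    using \<open>1 < R\<close> by (intro Bochner_Integration.integral_cong) (auto simp: space_arc_length sums_unique[OF a])
  also have "\<dots> = 2 * pi * a 0"
    using s[of 1] \<open>1 < R\<close> by (intro fourier_coefficient_power_series) simp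
  also have "a 0 = g 0"
    using a[of 0] \<open>1 < R\<close> powser_sums_zero_iff[of a "g 0"] by simp
  finally show ?thesis .
qed

section \<open>The Herglotz transform\<close>

text \<open>
  With \<open>w = z * cnj \<zeta>\<close> the kernel is \<open>(1 + w) / (1 - w) = 2 / (1 - w) - 1\<close>, a geometric series.
\<close>

lemma herglotz_kernel_sums:
  assumes "cmod z < 1" "\<zeta> \<in> unit_circle"
  shows "(\<lambda>n. ((if n = 0 then 1 else 2) * z ^ n) * cnj \<zeta> ^ n) sums ((\<zeta> + z) / (\<zeta> - z))"
proof -
  define w where "w = z * cnj \<zeta>"
  have w: "cmod w < 1" using assms by (simp add: w_def norm_mult)
  have \<zeta>: "\<zeta> * cnj \<zeta> = 1"
    using assms by (auto simp: complex_norm_square[symmetric])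
  have "(\<lambda>n. 2 * w ^ n - (if n = 0 then 1 else 0)) sums (2 * (1 / (1 - w)) - 1)"
    by (intro sums_diff sums_mult geometric_sums w) (use sums_single[of 0 "\<lambda>_. 1::complex"] in simp)
  moreover have "2 * w ^ n - (if n = 0 then 1 else 0) = ((if n = 0 then 1 else 2) * z ^ n) * cnj \<zeta> ^ n" for n
    by (simp only: w_def power_mult_distrib) simp
  moreover have "2 * (1 / (1 - w)) - 1 = (\<zeta> + z) / (\<zeta> - z)"
  proof -
    have "\<zeta> * w = z"
      using \<zeta> unfolding w_def by algebra
    then have "\<zeta> * (1 - w) = \<zeta> - z" "\<zeta> * (1 + w) = \<zeta> + z"
      by (simp_all only: distrib_left right_diff_distrib mult_1_right)
    moreover have "\<zeta> \<noteq> 0" "1 - w \<noteq> 0" using assms w by auto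
    ultimately have "(\<zeta> + z) / (\<zeta> - z) = (1 + w) / (1 - w)"
      by (metis mult_divide_mult_cancel_left)
    with \<open>1 - w \<noteq> 0\<close> show ?thesis by (simp add: field_simps)
  qed
  ultimately show ?thesis by simp
qed

definition poisson_kernel :: "complex \<Rightarrow> complex \<Rightarrow> real" where
  "poisson_kernel z \<zeta> = Re ((\<zeta> + z) / (\<zeta> - z))"

lemma poisson_kernel_eq:
  assumes "\<zeta> \<in> unit_circle"
  shows "poisson_kernel z \<zeta> = (1 - (cmod z)\<^sup>2) / (cmod (\<zeta> - z))\<^sup>2"
proof -
  have "(Re \<zeta>)\<^sup>2 + (Im \<zeta>)\<^sup>2 = 1"
    using assms by (simp flip: cmod_power2)
  then show ?thesis
    unfolding poisson_kernel_def Re_divide cmod_power2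
    by (simp add: algebra_simps power2_eq_square add_divide_distrib diff_divide_distrib)
qed

lemma poisson_kernel_nonneg:
  assumes "cmod z < 1" "\<zeta> \<in> unit_circle"
  shows "0 \<le> poisson_kernel z \<zeta>"
  using assms by (simp add: poisson_kernel_eq power_le_one)

lemma poisson_kernel_le:
  assumes "cmod z \<le> a" "a < 1" "\<zeta> \<in> unit_circle"
  shows "poisson_kernel z \<zeta> \<le> (1 + a) / (1 - a)"
proof -
  let ?b = "cmod z"
  have b: "?b < 1" "0 \<le> ?b" using assms by auto
  have *: "1 - ?b \<le> cmod (\<zeta> - z)"
    using assms norm_triangle_ineq2[of \<zeta> z] by simp
  have "poisson_kernel z \<zeta> \<le> (1 - ?b\<^sup>2) / (1 - ?b)\<^sup>2"
    unfolding poisson_kernel_eq[OF assms(3)] using b *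
    by (intro divide_left_mono power_mono mult_pos_pos zero_less_power) (auto simp: power_le_one)
  also have "\<dots> = (1 + ?b) / (1 - ?b)"
  proof -
    have "1 - ?b\<^sup>2 = (1 + ?b) * (1 - ?b)" by (simp add: power2_eq_square algebra_simps)
    then show ?thesis using b by (simp add: power2_eq_square)
  qed
  also have "\<dots> \<le> (1 + a) / (1 - a)"
    using assms b order_trans[OF norm_ge_zero assms(1)] by (intro frac_le) auto
  finally show ?thesis .
qed

lemma herglotz_kernel_continuous:
  assumes "cmod z < 1"
  shows "continuous_on unit_circle (\<lambda>\<zeta>. (\<zeta> + z) / (\<zeta> - z))"
  using assms by (intro continuous_intros) auto

lemma herglotz_kernel_integrable:
  assumes "cmod z < 1" and h: "integrable arc_length (h :: complex \<Rightarrow> complex)"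
  shows "integrable arc_length (\<lambda>\<zeta>. (\<zeta> + z) / (\<zeta> - z) * h \<zeta>)"
proof -
  have [measurable]: "(\<lambda>\<zeta>. (\<zeta> + z) / (\<zeta> - z)) \<in> borel_measurable arc_length" "h \<in> borel_measurable arc_length"
    using herglotz_kernel_continuous[OF assms(1)] h by (auto intro: borel_measurable_arc_length_continuous)
  have "bounded ((\<lambda>\<zeta>. (\<zeta> + z) / (\<zeta> - z)) ` unit_circle)"
    by (intro compact_imp_bounded compact_continuous_image herglotz_kernel_continuous assms) auto
  then obtain B where "\<And>\<zeta>. \<zeta> \<in> unit_circle \<Longrightarrow> cmod ((\<zeta> + z) / (\<zeta> - z)) \<le> B"
    unfolding bounded_iff by blast
  then have *: "cmod ((\<zeta> + z) / (\<zeta> - z) * h \<zeta>) \<le> B * cmod (h \<zeta>)" if "\<zeta> \<in> space arc_length" for \<zeta>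
    unfolding norm_mult using that by (intro mult_right_mono) (auto simp: space_arc_length)
  show ?thesis
  proof (rule Bochner_Integration.integrable_bound)
    show "integrable arc_length (\<lambda>\<zeta>. B * cmod (h \<zeta>))" using h by simp
    show "AE \<zeta> in arc_length. cmod ((\<zeta> + z) / (\<zeta> - z) * h \<zeta>) \<le> norm (B * cmod (h \<zeta>))"
      by (rule AE_I2) (use * in \<open>fastforce intro: order_trans\<close>)
  qed measurable
qed

definition herglotz :: "(complex \<Rightarrow> real) \<Rightarrow> complex \<Rightarrow> complex" where
  "herglotz h z = (\<integral>\<zeta>. (\<zeta> + z) / (\<zeta> - z) * complex_of_real (h \<zeta>) \<partial>arc_length) / (2 * pi)"

text \<open>
  Taylor expansion of the Herglotz transform: its coefficients are the Fourier coefficients of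
  \<open>h\<close>, doubled for positive index.
\<close>

lemma herglotz_sums:
  assumes h: "integrable arc_length h" and "cmod z < 1"
  shows "(\<lambda>n. (if n = 0 then 1 else 2) * ((\<integral>\<zeta>. cnj \<zeta> ^ n * complex_of_real (h \<zeta>) \<partial>arc_length) / (2 * pi)) * z ^ n)
           sums herglotz h z"
proof -
  let ?c = "\<lambda>n. (if n = 0 then 1 else 2) * z ^ n"
  define I where "I n = (\<integral>\<zeta>. cnj \<zeta> ^ n * complex_of_real (h \<zeta>) \<partial>arc_length)" for n
  have "summable (\<lambda>n. 2 * cmod z ^ n)"
    using assms by (intro summable_mult summable_geometric) simp
  then have "summable (\<lambda>n. cmod (?c n))"
    by (rule summable_comparison_test'[of _ 0]) (auto simp: norm_mult norm_power)
  then have "(\<lambda>n. ?c n * I n) sums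
          (\<integral>\<zeta>. (\<Sum>n. ?c n * cnj \<zeta> ^ n) * complex_of_real (h \<zeta>) \<partial>arc_length)"
    unfolding I_def using h by (intro sums_integral_arc_length) auto
  also have "(\<integral>\<zeta>. (\<Sum>n. ?c n * cnj \<zeta> ^ n) * complex_of_real (h \<zeta>) \<partial>arc_length) =
      (\<integral>\<zeta>. (\<zeta> + z) / (\<zeta> - z) * complex_of_real (h \<zeta>) \<partial>arc_length)"
    using sums_unique[OF herglotz_kernel_sums[OF assms(2)]]
    by (intro Bochner_Integration.integral_cong) (simp_all add: space_arc_length)
  finally have "(\<lambda>n. ?c n * I n / (2 * pi)) sums herglotz h z"
    unfolding herglotz_def by (rule sums_divide)
  moreover have "?c n * I n / (2 * pi) = (if n = 0 then 1 else 2) * (I n / (2 * pi)) * z ^ n" for n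
    by simp
  ultimately show ?thesis
    unfolding I_def by (simp only:)
qed

lemma herglotz_holomorphic:
  assumes "integrable arc_length h"
  shows "herglotz h holomorphic_on unit_disk"
proof (rule power_series_holomorphic)
  fix z :: complex assume "z \<in> unit_disk"
  then have "cmod z < 1" by simp
  from herglotz_sums[OF assms this]
  show "(\<lambda>n. (if n = 0 then 1 else 2) *
      ((\<integral>\<zeta>. cnj \<zeta> ^ n * complex_of_real (h \<zeta>) \<partial>arc_length) / (2 * pi)) * (z - 0) ^ n) sums herglotz h z"
    by (simp only: diff_zero)
qed

lemma poisson_kernel_integrable:
  assumes "cmod z < 1" and h: "integrable arc_length h"
  shows "integrable arc_length (\<lambda>\<zeta>. poisson_kernel z \<zeta> * h \<zeta>)"
  using integrable_Re[OF herglotz_kernel_integrable[OF assms(1), of "\<lambda>\<zeta>. complex_of_real (h \<zeta>)"]] h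
  by (simp add: poisson_kernel_def del: times_divide_eq_left)

lemma Re_herglotz:
  assumes "integrable arc_length h" and "cmod z < 1"
  shows "Re (herglotz h z) = (\<integral>\<zeta>. poisson_kernel z \<zeta> * h \<zeta> \<partial>arc_length) / (2 * pi)"
proof -
  have "Re (herglotz h z) = Re (\<integral>\<zeta>. (\<zeta> + z) / (\<zeta> - z) * complex_of_real (h \<zeta>) \<partial>arc_length) / (2 * pi)"
    unfolding herglotz_def using Re_divide_of_real[of _ "2 * pi"] by simp
  also have "Re (\<integral>\<zeta>. (\<zeta> + z) / (\<zeta> - z) * complex_of_real (h \<zeta>) \<partial>arc_length) =
      (\<integral>\<zeta>. Re ((\<zeta> + z) / (\<zeta> - z) * complex_of_real (h \<zeta>)) \<partial>arc_length)"
    using assms by (intro integral_Re[symmetric] herglotz_kernel_integrable) auto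
  finally show ?thesis by (simp add: poisson_kernel_def del: times_divide_eq_left)
qed

lemma Re_herglotz_mono:
  assumes "integrable arc_length h" "integrable arc_length k" "cmod z < 1"
    and "\<And>\<zeta>. \<zeta> \<in> unit_circle \<Longrightarrow> h \<zeta> \<le> k \<zeta>"
  shows "Re (herglotz h z) \<le> Re (herglotz k z)"
  unfolding Re_herglotz[OF assms(1,3)] Re_herglotz[OF assms(2,3)]
  using assms
  by (intro divide_right_mono integral_mono mult_left_mono poisson_kernel_integrable poisson_kernel_nonneg)
     (auto simp: space_arc_length)

text \<open>
  Harnack's inequality: the Poisson kernel at a point of modulus at most \<open>a\<close> is bounded by \<open>(1 +
  a) / (1 - a)\<close>.
\<close>

lemma Re_herglotz_le:
  assumes h: "integrable arc_length h" and z: "cmod z \<le> a" "a < 1"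
    and nonneg: "\<And>\<zeta>. \<zeta> \<in> unit_circle \<Longrightarrow> 0 \<le> h \<zeta>"
  shows "2 * pi * Re (herglotz h z) \<le> (1 + a) / (1 - a) * (\<integral>\<zeta>. h \<zeta> \<partial>arc_length)"
proof -
  have "cmod z < 1" using z by simp
  have "2 * pi * Re (herglotz h z) = (\<integral>\<zeta>. poisson_kernel z \<zeta> * h \<zeta> \<partial>arc_length)"
    by (simp add: Re_herglotz[OF h \<open>cmod z < 1\<close>])
  also have "\<dots> \<le> (\<integral>\<zeta>. (1 + a) / (1 - a) * h \<zeta> \<partial>arc_length)"
    using h z nonneg \<open>cmod z < 1\<close>
    by (intro integral_mono mult_right_mono poisson_kernel_integrable poisson_kernel_le) (auto simp: space_arc_length)
  finally show ?thesis by simp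
qed

lemma herglotz_add:
  assumes "integrable arc_length h" "integrable arc_length k" "cmod z < 1"
  shows "herglotz (\<lambda>\<zeta>. h \<zeta> + k \<zeta>) z = herglotz h z + herglotz k z"
  using assms herglotz_kernel_integrable[OF assms(3), of "\<lambda>\<zeta>. complex_of_real (h \<zeta>)"]
     herglotz_kernel_integrable[OF assms(3), of "\<lambda>\<zeta>. complex_of_real (k \<zeta>)"]
  by (simp add: herglotz_def distrib_left add_divide_distrib)

lemma herglotz_minus: "herglotz (\<lambda>\<zeta>. - h \<zeta>) z = - herglotz h z"
  by (simp add: herglotz_def)

text \<open>
  Schwarz's formula. The Fourier coefficients of \<open>Re F = (F + cnj F) / 2\<close> are known: \<open>F\<close>
  contributes its Taylor coefficients, while \<open>cnj F\<close> contributes only to index 0, since \<open>\<zeta> ^ n *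
  F\<close> has mean zero for \<open>n > 0\<close>.
\<close>

lemma herglotz_Re:
  fixes F :: "complex \<Rightarrow> complex"
  assumes F: "F holomorphic_on ball 0 R" and "1 < R" and z: "cmod z < 1"
  shows "herglotz (\<lambda>\<zeta>. Re (F \<zeta>)) z = F z - \<i> * Im (F 0)"
proof -
  obtain a where a: "\<And>z. cmod z < R \<Longrightarrow> (\<lambda>n. a n * z ^ n) sums F z"
    and s: "\<And>r. 0 \<le> r \<Longrightarrow> r < R \<Longrightarrow> summable (\<lambda>n. cmod (a n * of_real r ^ n))"
    using power_series_of_dilation[OF F] by blast
  have a0: "a 0 = F 0"
    using a[of 0] \<open>1 < R\<close> powser_sums_zero_iff[of a "F 0"] by simp
  have cF: "continuous_on unit_circle F"
    by (rule holomorphic_on_imp_continuous_on[OF holomorphic_on_subset[OF F]]) (use \<open>1 < R\<close> in auto)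
  have i1: "(\<integral>\<zeta>. cnj \<zeta> ^ n * F \<zeta> \<partial>arc_length) = 2 * pi * a n" for n
  proof -
    have "(\<integral>\<zeta>. cnj \<zeta> ^ n * F \<zeta> \<partial>arc_length) = (\<integral>\<zeta>. (\<Sum>n. a n * \<zeta> ^ n) * cnj \<zeta> ^ n \<partial>arc_length)"
      using \<open>1 < R\<close> by (intro Bochner_Integration.integral_cong) (auto simp: space_arc_length sums_unique[OF a])
    also have "\<dots> = 2 * pi * a n"
      using s[of 1] \<open>1 < R\<close> by (intro fourier_coefficient_power_series) simp
    finally show ?thesis .
  qed
  have i2: "(\<integral>\<zeta>. cnj \<zeta> ^ n * cnj (F \<zeta>) \<partial>arc_length) = (if n = 0 then 2 * pi * cnj (F 0) else 0)" for n
  proof -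
    have "(\<integral>\<zeta>. cnj \<zeta> ^ n * cnj (F \<zeta>) \<partial>arc_length) = cnj (\<integral>\<zeta>. \<zeta> ^ n * F \<zeta> \<partial>arc_length)"
      by (subst Bochner_Integration.integral_cnj[symmetric]) simp
    also have "(\<integral>\<zeta>. \<zeta> ^ n * F \<zeta> \<partial>arc_length) = 2 * pi * (0 ^ n * F 0)"
      by (rule mean_value_arc_length[OF _ \<open>1 < R\<close>]) (intro holomorphic_intros F)
    finally show ?thesis by (simp add: power_0_left)
  qed
  have coeff: "(if n = 0 then 1 else 2) *
      ((\<integral>\<zeta>. cnj \<zeta> ^ n * complex_of_real (Re (F \<zeta>)) \<partial>arc_length) / (2 * pi)) * z ^ n =
      a n * z ^ n - (if n = 0 then \<i> * Im (F 0) else 0)" for n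
  proof -
    have "(\<integral>\<zeta>. cnj \<zeta> ^ n * complex_of_real (Re (F \<zeta>)) \<partial>arc_length) =
        (\<integral>\<zeta>. (cnj \<zeta> ^ n * F \<zeta> + cnj \<zeta> ^ n * cnj (F \<zeta>)) / 2 \<partial>arc_length)"
      by (simp add: complex_add_cnj flip: distrib_left)
    also have "\<dots> = ((\<integral>\<zeta>. cnj \<zeta> ^ n * F \<zeta> \<partial>arc_length) + (\<integral>\<zeta>. cnj \<zeta> ^ n * cnj (F \<zeta>) \<partial>arc_length)) / 2"
      by (subst Bochner_Integration.integral_add[symmetric])
         (auto intro!: integrable_arc_length_continuous continuous_intros cF)
    finally have *: "(\<integral>\<zeta>. cnj \<zeta> ^ n * complex_of_real (Re (F \<zeta>)) \<partial>arc_length) =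
        (2 * pi * a n + (if n = 0 then 2 * pi * cnj (F 0) else 0)) / 2"
      unfolding i1 i2 .
    show ?thesis
    proof (cases "n = 0")
      case True
      have "(2 * pi * F 0 + 2 * pi * cnj (F 0)) / 2 / (2 * pi) = F 0 - \<i> * Im (F 0)"
        by (simp add: complex_eq_iff)
      with True show ?thesis unfolding * by (simp only: a0) simp
    next
      case False
      then show ?thesis unfolding * by simp
    qed
  qed
  have "(\<lambda>n. a n * z ^ n - (if n = 0 then \<i> * Im (F 0) else 0)) sums (F z - \<i> * Im (F 0))"
    using z \<open>1 < R\<close> by (intro sums_diff a) (use sums_single[of 0 "\<lambda>_. \<i> * complex_of_real (Im (F 0))"] in auto)
  moreover have "(\<lambda>n. a n * z ^ n - (if n = 0 then \<i> * Im (F 0) else 0)) sums herglotz (\<lambda>\<zeta>. Re (F \<zeta>)) z"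
    using herglotz_sums[OF _ z, of "\<lambda>\<zeta>. Re (F \<zeta>)"] unfolding coeff
    by (auto intro: integrable_arc_length_continuous continuous_intros cF)
  ultimately show ?thesis by (rule sums_unique2[symmetric])
qed

lemma Re_herglotz_const:
  assumes "cmod z < 1"
  shows "Re (herglotz (\<lambda>_. c) z) = c"
  using herglotz_Re[of "\<lambda>_. complex_of_real c" 2 z] assms by simp

section \<open>Majorants by the Herglotz transform of boundary values\<close>

text \<open>
  On the circle a product \<open>p * cnj q\<close> is a Laurent polynomial, and its negative powers can be
  turned into positive ones by conjugating, which does not affect the real part. Peeling off the
  constant terms of both polynomials makes this an induction.
\<close>

lemma Re_poly_mult_cnj_on_circle:
  fixes p q :: "complex poly"
  shows "\<exists>s. \<forall>\<zeta>\<in>unit_circle. Re (poly p \<zeta> * cnj (poly q \<zeta>)) = Re (poly s \<zeta>)"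
proof (induction p arbitrary: q)
  case 0
  show ?case by (rule exI[of _ 0]) simp
next
  case (pCons a p)
  obtain b q' where q: "q = pCons b q'" by (rule pCons_cases)
  obtain s where s: "\<And>\<zeta>. \<zeta> \<in> unit_circle \<Longrightarrow> Re (poly p \<zeta> * cnj (poly q' \<zeta>)) = Re (poly s \<zeta>)"
    using pCons.IH by blast
  \<comment> \<open>The cross term \<open>a * cnj (\<zeta> * q')\<close> is replaced by its conjugate.\<close>
  let ?s = "[:a * cnj b:] + pCons 0 (smult (cnj a) q') + pCons 0 (smult (cnj b) p) + s"
  have "Re (poly (pCons a p) \<zeta> * cnj (poly q \<zeta>)) = Re (poly ?s \<zeta>)" if "\<zeta> \<in> unit_circle" for \<zeta>
  proof -
    have "\<zeta> * cnj \<zeta> = 1"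
      using that by (auto simp: complex_norm_square[symmetric])
    then have "poly (pCons a p) \<zeta> * cnj (poly q \<zeta>) =
        a * cnj b + cnj (cnj a * \<zeta> * poly q' \<zeta>) + cnj b * \<zeta> * poly p \<zeta> + poly p \<zeta> * cnj (poly q' \<zeta>)"
      unfolding q poly_pCons complex_cnj_add complex_cnj_mult complex_cnj_cnj by algebra
    then have "Re (poly (pCons a p) \<zeta> * cnj (poly q \<zeta>)) =
        Re (a * cnj b) + Re (cnj a * \<zeta> * poly q' \<zeta>) + Re (cnj b * \<zeta> * poly p \<zeta>) + Re (poly s \<zeta>)"
      using s[OF that] by (simp only: plus_complex.sel cnj.sel)
    also have "\<dots> = Re (poly ?s \<zeta>)"
      by (simp add: algebra_simps)
    finally show ?thesis .
  qed
  then show ?case by blast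
qed

text \<open>
  Real polynomials in two variables restrict to trigonometric polynomials on the circle.
  Products are handled by \<open>2 Re p Re q = Re (p q) + Re (p cnj q)\<close>.
\<close>

lemma real_polynomial_function_eq_Re_poly_on_circle:
  assumes "real_polynomial_function (g :: complex \<Rightarrow> real)"
  shows "\<exists>p. \<forall>\<zeta>\<in>unit_circle. g \<zeta> = Re (poly p \<zeta>)"
  using assms
proof induction
  case (linear f)
  then interpret bounded_linear f .
  have "f \<zeta> = Re (poly [:0, Complex (f 1) (- f \<i>):] \<zeta>)" for \<zeta>
  proof -
    have "f \<zeta> = f (Re \<zeta> *\<^sub>R 1 + Im \<zeta> *\<^sub>R \<i>)"
      by (rule arg_cong[of _ _ f]) (simp add: complex_eq_iff)
    also have "\<dots> = Re \<zeta> * f 1 + Im \<zeta> * f \<i>"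
      by (simp only: add scale real_scaleR_def)
    finally show ?thesis by simp
  qed
  then show ?case by blast
next
  case (const c)
  show ?case by (rule exI[of _ "[:of_real c:]"]) simp
next
  case (add f g)
  then obtain p q where "\<forall>\<zeta>\<in>unit_circle. f \<zeta> = Re (poly p \<zeta>)" "\<forall>\<zeta>\<in>unit_circle. g \<zeta> = Re (poly q \<zeta>)"
    by blast
  then show ?case by (intro exI[of _ "p + q"]) simp
next
  case (mult f g)
  then obtain p q where pq: "\<forall>\<zeta>\<in>unit_circle. f \<zeta> = Re (poly p \<zeta>)" "\<forall>\<zeta>\<in>unit_circle. g \<zeta> = Re (poly q \<zeta>)"
    by blast
  obtain s where s: "\<forall>\<zeta>\<in>unit_circle. Re (poly p \<zeta> * cnj (poly q \<zeta>)) = Re (poly s \<zeta>)"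
    using Re_poly_mult_cnj_on_circle by blast
  have "f \<zeta> * g \<zeta> = Re (poly (smult (1/2) (p * q + s)) \<zeta>)" if "\<zeta> \<in> unit_circle" for \<zeta>
  proof -
    have "2 * (f \<zeta> * g \<zeta>) = Re (poly p \<zeta> * poly q \<zeta>) + Re (poly p \<zeta> * cnj (poly q \<zeta>))"
      using pq that by (simp add: algebra_simps)
    with s that show ?thesis by simp
  qed
  then show ?case by blast
qed

text \<open>
  A subharmonicity statement for \<open>log |F|\<close> that is insensitive to the zeros of \<open>F\<close>: if the real
  part of a polynomial \<open>p\<close> lies between \<open>u\<close> and \<open>u + \<epsilon>\<close> on the circle, then \<open>F exp (- p)\<close> has
  modulus at most 1 there, hence inside, and \<open>Re p\<close> is the Poisson integral of its boundary
  values.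
\<close>

lemma cmod_le_exp_herglotz:
  fixes F :: "complex \<Rightarrow> complex"
  assumes F: "F holomorphic_on ball 0 R" and "1 < R"
    and u: "continuous_on unit_circle u"
    and le: "\<And>\<zeta>. \<zeta> \<in> unit_circle \<Longrightarrow> cmod (F \<zeta>) \<le> exp (u \<zeta>)"
    and z: "cmod z < 1"
  shows "cmod (F z) \<le> exp (Re (herglotz u z))"
proof -
  have "cmod (F z) \<le> exp (Re (herglotz u z) + \<epsilon>)" if "\<epsilon> > 0" for \<epsilon>
  proof -
    have "continuous_on unit_circle (\<lambda>\<zeta>. u \<zeta> + \<epsilon> / 2)"
      by (intro continuous_intros u)
    then obtain g where g: "real_polynomial_function g"
      and ug: "\<And>\<zeta>. \<zeta> \<in> unit_circle \<Longrightarrow> \<bar>(u \<zeta> + \<epsilon> / 2) - g \<zeta>\<bar> < \<epsilon> / 2"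
      by (rule Stone_Weierstrass_real_polynomial_function[OF compact_sphere _ half_gt_zero[OF \<open>\<epsilon> > 0\<close>]]) blast
    obtain p where p: "\<And>\<zeta>. \<zeta> \<in> unit_circle \<Longrightarrow> g \<zeta> = Re (poly p \<zeta>)"
      using real_polynomial_function_eq_Re_poly_on_circle[OF g] by blast
    have up: "u \<zeta> \<le> Re (poly p \<zeta>)" "Re (poly p \<zeta>) \<le> u \<zeta> + \<epsilon>" if "\<zeta> \<in> unit_circle" for \<zeta>
      using ug[OF that] p[OF that] by linarith+
    have "cmod (F z * exp (- poly p z)) \<le> 1"
    proof (rule maximum_modulus_frontier[where S = "cball 0 1" and f = "\<lambda>z. F z * exp (- poly p z)"])
      have sub: "cball 0 1 \<subseteq> ball 0 R" using \<open>1 < R\<close> by auto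
      show "(\<lambda>z. F z * exp (- poly p z)) holomorphic_on interior (cball 0 1)"
        using \<open>1 < R\<close> by (intro holomorphic_intros holomorphic_on_subset[OF F]) auto
      show "continuous_on (closure (cball 0 1)) (\<lambda>z. F z * exp (- poly p z))"
        using sub by (intro continuous_intros continuous_on_subset[OF holomorphic_on_imp_continuous_on[OF F]]) auto
      show "cmod (F \<zeta> * exp (- poly p \<zeta>)) \<le> 1" if "\<zeta> \<in> frontier (cball 0 1)" for \<zeta>
      proof -
        have \<zeta>: "\<zeta> \<in> unit_circle" using that by (simp add: frontier_cball)
        have "cmod (F \<zeta> * exp (- poly p \<zeta>)) \<le> exp (u \<zeta>) * exp (- Re (poly p \<zeta>))"
          by (auto simp: norm_mult intro!: mult_right_mono le \<zeta>)
        also have "\<dots> \<le> 1"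
          using up(1)[OF \<zeta>] by (simp flip: exp_add)
        finally show ?thesis .
      qed
    qed (use z in auto)
    then have "cmod (F z) \<le> exp (Re (poly p z))"
      by (simp add: norm_mult norm_divide exp_minus field_simps)
    also have "Re (poly p z) = Re (herglotz (\<lambda>\<zeta>. Re (poly p \<zeta>)) z)"
      using z by (subst herglotz_Re[of _ 2]) (auto intro: holomorphic_intros)
    also have "\<dots> \<le> Re (herglotz (\<lambda>\<zeta>. u \<zeta> + \<epsilon>) z)"
      by (intro Re_herglotz_mono integrable_arc_length_continuous continuous_intros u z up)
    also have "\<dots> = Re (herglotz u z) + \<epsilon>"
      by (subst herglotz_add) (auto intro!: integrable_arc_length_continuous continuous_intros u z simp: Re_herglotz_const[OF z])
    finally show ?thesis by simp
  qed
  then have "eventually (\<lambda>\<epsilon>. cmod (F z) \<le> exp (Re (herglotz u z) + \<epsilon>)) (at_right 0)"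
    by (intro eventually_mono[OF eventually_at_right_less])
  moreover have "((\<lambda>\<epsilon>. exp (Re (herglotz u z) + \<epsilon>)) \<longlongrightarrow> exp (Re (herglotz u z) + 0)) (at_right 0)"
    by (intro tendsto_intros)
  ultimately have "cmod (F z) \<le> exp (Re (herglotz u z) + 0)"
    by (intro tendsto_lowerbound) auto
  then show ?thesis by simp
qed

section \<open>Boundary behaviour of dilations\<close>

lemma dilation_holomorphic:
  fixes g :: "complex \<Rightarrow> complex"
  assumes "g holomorphic_on unit_disk" "0 < r" 
  shows "(\<lambda>z. g (complex_of_real r * z)) holomorphic_on ball 0 (1 / r)"
proof (rule holomorphic_on_compose_gen[OF _ assms(1), unfolded o_def])
  show "(\<lambda>z. complex_of_real r * z) ` ball 0 (1 / r) \<subseteq> unit_disk"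
    using \<open>0 < r\<close> by (auto simp: norm_mult field_simps)
qed (intro holomorphic_intros)

lemma dilation_continuous_on_circle:
  fixes g :: "complex \<Rightarrow> complex"
  assumes "continuous_on unit_disk g" "0 \<le> r" "r < 1"
  shows "continuous_on unit_circle (\<lambda>\<zeta>. g (complex_of_real r * \<zeta>))"
  by (rule continuous_on_compose2[OF assms(1)])
     (use assms in \<open>auto intro!: continuous_intros simp: norm_mult\<close>)

text \<open>
  By Parseval both sides are sums over the Taylor coefficients, and termwise the claim is \<open>(x -
  y)\<^sup>2 \<le> x\<^sup>2 - y\<^sup>2\<close> for \<open>x = r ^ n \<ge> y = s ^ n \<ge> 0\<close>.
\<close>

lemma integral_norm_square_dilation_diff_le:
  fixes g :: "complex \<Rightarrow> complex" and r s :: real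
  assumes g: "g holomorphic_on unit_disk" and sr: "0 \<le> s" "s \<le> r" "r < 1"
  shows "(\<integral>\<zeta>. (cmod (g (r * \<zeta>) - g (s * \<zeta>)))\<^sup>2 \<partial>arc_length) \<le>
           (\<integral>\<zeta>. (cmod (g (r * \<zeta>)))\<^sup>2 \<partial>arc_length) - (\<integral>\<zeta>. (cmod (g (s * \<zeta>)))\<^sup>2 \<partial>arc_length)"
proof -
  obtain a where a: "\<And>z. cmod z < 1 \<Longrightarrow> (\<lambda>n. a n * z ^ n) sums g z"
    and s: "\<And>r. 0 \<le> r \<Longrightarrow> r < 1 \<Longrightarrow> summable (\<lambda>n. cmod (a n * of_real r ^ n))"
    using power_series_of_dilation[OF g] by blast
  have gs: "(\<lambda>n. (a n * complex_of_real t ^ n) * \<zeta> ^ n) sums g (t * \<zeta>)"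
    if "0 \<le> t" "t < 1" "\<zeta> \<in> unit_circle" for t \<zeta>
    using a[of "t * \<zeta>"] that by (simp add: norm_mult power_mult_distrib mult.assoc)
  have P: "(\<lambda>n. 2 * pi * (cmod (a n * complex_of_real t ^ n))\<^sup>2) sums
             (\<integral>\<zeta>. (cmod (g (t * \<zeta>)))\<^sup>2 \<partial>arc_length)" if "0 \<le> t" "t < 1" for t
  proof -
    have "(\<integral>\<zeta>. (cmod (g (t * \<zeta>)))\<^sup>2 \<partial>arc_length) =
        (\<integral>\<zeta>. (cmod (\<Sum>n. (a n * complex_of_real t ^ n) * \<zeta> ^ n))\<^sup>2 \<partial>arc_length)"
      by (intro Bochner_Integration.integral_cong refl)
         (simp add: space_arc_length sums_unique[OF gs[OF that]])
    then show ?thesis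
      using parseval_power_series[OF s[OF that]] by simp
  qed
  let ?d = "\<lambda>n. a n * complex_of_real r ^ n - a n * complex_of_real s ^ n"
  have "summable (\<lambda>n. cmod (?d n))"
    by (rule summable_comparison_test'[OF summable_add[OF s[of r] s[of s]], of 0])
       (use sr norm_triangle_ineq4 in auto)
  then have D: "(\<lambda>n. 2 * pi * (cmod (?d n))\<^sup>2) sums
      (\<integral>\<zeta>. (cmod (\<Sum>n. ?d n * \<zeta> ^ n))\<^sup>2 \<partial>arc_length)"
    by (rule parseval_power_series)
  have "(\<integral>\<zeta>. (cmod (\<Sum>n. ?d n * \<zeta> ^ n))\<^sup>2 \<partial>arc_length) =
      (\<integral>\<zeta>. (cmod (g (r * \<zeta>) - g (s * \<zeta>)))\<^sup>2 \<partial>arc_length)"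
  proof (intro Bochner_Integration.integral_cong refl)
    fix \<zeta> assume "\<zeta> \<in> space arc_length"
    then have "(\<lambda>n. ?d n * \<zeta> ^ n) sums (g (r * \<zeta>) - g (s * \<zeta>))"
      using sums_diff[OF gs[of r \<zeta>] gs[of s \<zeta>]] sr by (simp add: space_arc_length left_diff_distrib)
    then show "(cmod (\<Sum>n. ?d n * \<zeta> ^ n))\<^sup>2 = (cmod (g (r * \<zeta>) - g (s * \<zeta>)))\<^sup>2"
      by (simp add: sums_unique[symmetric])
  qed
  with D have D': "(\<lambda>n. 2 * pi * (cmod (?d n))\<^sup>2) sums
      (\<integral>\<zeta>. (cmod (g (r * \<zeta>) - g (s * \<zeta>)))\<^sup>2 \<partial>arc_length)" by simp
  have E: "(\<lambda>n. 2 * pi * (cmod (a n * complex_of_real r ^ n))\<^sup>2 - 2 * pi * (cmod (a n * complex_of_real s ^ n))\<^sup>2) sums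
      ((\<integral>\<zeta>. (cmod (g (r * \<zeta>)))\<^sup>2 \<partial>arc_length) - (\<integral>\<zeta>. (cmod (g (s * \<zeta>)))\<^sup>2 \<partial>arc_length))"
    using sr by (intro sums_diff P) auto
  show ?thesis
  proof (rule sums_le[OF _ D' E])
    fix n
    have rs: "s ^ n \<le> r ^ n" "0 \<le> s ^ n" using sr by (auto intro: power_mono)
    have "?d n = a n * complex_of_real (r ^ n - s ^ n)" by (simp add: algebra_simps)
    then have "(cmod (?d n))\<^sup>2 = (cmod (a n))\<^sup>2 * (r ^ n - s ^ n)\<^sup>2"
      by (simp only: norm_mult power_mult_distrib norm_of_real power2_abs)
    also have "\<dots> \<le> (cmod (a n))\<^sup>2 * ((r ^ n)\<^sup>2 - (s ^ n)\<^sup>2)"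
    proof (rule mult_left_mono)
      have "0 \<le> 2 * s ^ n * (r ^ n - s ^ n)" using rs by simp
      then show "(r ^ n - s ^ n)\<^sup>2 \<le> (r ^ n)\<^sup>2 - (s ^ n)\<^sup>2" by (simp add: power2_eq_square algebra_simps)
    qed simp
    also have "\<dots> = (cmod (a n * complex_of_real r ^ n))\<^sup>2 - (cmod (a n * complex_of_real s ^ n))\<^sup>2"
      using sr by (simp add: norm_mult norm_power power_mult_distrib right_diff_distrib)
    finally show "2 * pi * (cmod (?d n))\<^sup>2 \<le>
        2 * pi * (cmod (a n * complex_of_real r ^ n))\<^sup>2 - 2 * pi * (cmod (a n * complex_of_real s ^ n))\<^sup>2"
      by (simp flip: right_diff_distrib)
  qed
qed

lemma bounded_holomorphicE:
  assumes "bounded_holomorphic g"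
  obtains B where "B \<ge> 1" "\<And>z. cmod z < 1 \<Longrightarrow> cmod (g z) \<le> B"
proof -
  have "bounded (g ` unit_disk)"
    using assms by (simp add: bounded_holomorphic_def)
  then obtain B where "\<forall>w \<in> g ` unit_disk. cmod w \<le> B"
    unfolding bounded_iff by blast
  then have B: "cmod (g z) \<le> B" if "cmod z < 1" for z
    using that by simp
  show thesis
    by (rule that[of "max 1 B"]) (use B in \<open>auto simp: le_max_iff_disj\<close>)
qed

text \<open>
  Existence of boundary values along a sequence of radii: the square means increase with the
  radius and are bounded, hence the dilations are Cauchy in \<open>L\<^sup>2\<close>, so in \<open>L\<^sup>1\<close>, and a
  subsequence converges almost everywhere.
\<close>

lemma AE_convergent_subsequence_of_dilations:
  assumes g: "bounded_holomorphic g"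
    and r: "incseq r" "\<And>j::nat. 0 \<le> r j" "\<And>j. r j < 1"
  obtains q :: "nat \<Rightarrow> nat"
  where "strict_mono q" "AE \<zeta> in arc_length. convergent (\<lambda>j. g (complex_of_real (r (q j)) * \<zeta>))"
proof -
  obtain B where B: "\<And>z. cmod z < 1 \<Longrightarrow> cmod (g z) \<le> B"
    using bounded_holomorphicE[OF g] by metis
  have hol: "g holomorphic_on unit_disk" using g by (simp add: bounded_holomorphic_def)
  have cont: "continuous_on unit_circle (\<lambda>\<zeta>. g (complex_of_real (r j) * \<zeta>))" for j
    by (intro dilation_continuous_on_circle holomorphic_on_imp_continuous_on hol r)
  define M where "M j = (\<integral>\<zeta>. (cmod (g (r j * \<zeta>)))\<^sup>2 \<partial>arc_length)" for j
  have M_diff: "(\<integral>\<zeta>. (cmod (g (r j * \<zeta>) - g (r i * \<zeta>)))\<^sup>2 \<partial>arc_length) \<le> M j - M i" if "i \<le> j" for i j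
    unfolding M_def using that r by (intro integral_norm_square_dilation_diff_le hol) (auto simp: incseq_def)
  have "incseq M"
  proof (rule incseq_SucI)
    fix j
    have "0 \<le> (\<integral>\<zeta>. (cmod (g (r (Suc j) * \<zeta>) - g (r j * \<zeta>)))\<^sup>2 \<partial>arc_length)"
      by (intro Bochner_Integration.integral_nonneg) simp
    also have "\<dots> \<le> M (Suc j) - M j" by (rule M_diff) simp
    finally show "M j \<le> M (Suc j)" by simp
  qed
  moreover have "M j \<le> 2 * pi * B\<^sup>2" for j
  proof -
    have "M j \<le> (\<integral>\<zeta>. B\<^sup>2 \<partial>arc_length)"
      unfolding M_def using r
      by (intro integral_mono integrable_arc_length_continuous continuous_intros cont power_mono B)
         (auto simp: space_arc_length norm_mult)
    then show ?thesis by simp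
  qed
  ultimately have "Cauchy M"
    by (metis incseq_convergent LIMSEQ_imp_Cauchy)
  have "\<exists>N. \<forall>i\<ge>N. \<forall>j\<ge>N. (\<integral>\<zeta>. cmod (g (r i * \<zeta>) - g (r j * \<zeta>)) \<partial>arc_length) < e" if "e > 0" for e
  proof -
    \<comment> \<open>\<open>L\<^sup>1\<close> is controlled by \<open>L\<^sup>2\<close> via \<open>2 x \<le> x\<^sup>2 / \<delta> + \<delta>\<close>; the constant term contributes
      \<open>\<pi> \<delta> = e / 2\<close> to the integral.\<close>
    define \<delta> where "\<delta> = e / (2 * pi)"
    have "\<delta> > 0" using that by (simp add: \<delta>_def)
    then have "0 < e * \<delta>" using that by simp
    then obtain N where "\<forall>i\<ge>N. \<forall>j\<ge>N. dist (M i) (M j) < e * \<delta>"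
      using metric_CauchyD[OF \<open>Cauchy M\<close>] by blast
    then have N: "\<bar>M i - M j\<bar> < e * \<delta>" if "i \<ge> N" "j \<ge> N" for i j
      using that by (simp add: dist_real_def)
    have *: "(\<integral>\<zeta>. cmod (g (r i * \<zeta>) - g (r j * \<zeta>)) \<partial>arc_length) < e" if ij: "i \<ge> N" "j \<ge> N" "j \<le> i" for i j
    proof -
      let ?x = "\<lambda>\<zeta>::complex. cmod (g (r i * \<zeta>) - g (r j * \<zeta>))"
      have "(\<integral>\<zeta>. ?x \<zeta> \<partial>arc_length) \<le> (\<integral>\<zeta>. (?x \<zeta>)\<^sup>2 / (2 * \<delta>) + \<delta> / 2 \<partial>arc_length)"
      proof (intro integral_mono)
        fix \<zeta>
        have "0 \<le> (?x \<zeta> - \<delta>)\<^sup>2" by simp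
        then show "?x \<zeta> \<le> (?x \<zeta>)\<^sup>2 / (2 * \<delta>) + \<delta> / 2"
          using \<open>\<delta> > 0\<close> by (simp add: field_simps power2_eq_square)
      qed (auto intro!: integrable_arc_length_continuous continuous_intros cont simp: \<open>\<delta> > 0\<close>[THEN less_imp_neq, symmetric])
      also have "\<dots> = (\<integral>\<zeta>. (?x \<zeta>)\<^sup>2 \<partial>arc_length) / (2 * \<delta>) + pi * \<delta>"
        by (subst Bochner_Integration.integral_add)
           (auto intro!: integrable_arc_length_continuous continuous_intros cont simp: \<open>\<delta> > 0\<close>[THEN less_imp_neq, symmetric])
      also have "(\<integral>\<zeta>. (?x \<zeta>)\<^sup>2 \<partial>arc_length) / (2 * \<delta>) < (e * \<delta>) / (2 * \<delta>)"
        using M_diff[OF ij(3)] N[OF ij(1,2)] \<open>\<delta> > 0\<close> by (intro divide_strict_right_mono) auto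
      also have "(e * \<delta>) / (2 * \<delta>) + pi * \<delta> = e"
        using \<open>\<delta> > 0\<close> by (simp add: \<delta>_def)
      finally show ?thesis by simp
    qed
    have "(\<integral>\<zeta>. cmod (g (r i * \<zeta>) - g (r j * \<zeta>)) \<partial>arc_length) < e" if ij: "i \<ge> N" "j \<ge> N" for i j
      using *[OF ij] *[OF ij(2,1)] by (cases "j \<le> i") (simp_all add: norm_minus_commute)
    then show ?thesis by (intro exI[of _ N] allI impI)
  qed
  then show thesis
  proof (rule cauchy_L1_AE_cauchy_subseq[of arc_length "\<lambda>j \<zeta>. g (complex_of_real (r j) * \<zeta>)", rotated])
    fix q :: "nat \<Rightarrow> nat"
    assume "strict_mono q" "AE \<zeta> in arc_length. Cauchy (\<lambda>j. g (complex_of_real (r (q j)) * \<zeta>))"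
    then show thesis
      by (intro that) (simp_all add: Cauchy_convergent_iff)
  qed (assumption, rule integrable_arc_length_continuous[OF cont])
qed

text \<open>
  As \<open>g\<close> has a holomorphic logarithm \<open>l\<close>, the nonnegative functions \<open>ln B - ln |g|\<close> have the
  same mean over all circles about 0. By Fatou's lemma their lower limit is integrable, hence
  finite almost everywhere, whereas it would be infinite wherever \<open>g\<close> tends to 0.
\<close>

lemma AE_lim_dilations_nonzero:
  assumes g: "bounded_holomorphic g" and nz: "\<And>z. z \<in> unit_disk \<Longrightarrow> g z \<noteq> 0"
    and r: "\<And>j::nat. 0 \<le> r j" "\<And>j. r j < 1"
  shows "AE \<zeta> in arc_length. \<not> (\<lambda>j. g (complex_of_real (r j) * \<zeta>)) \<longlonglongrightarrow> 0"
proof -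
  obtain B where B: "B \<ge> 1" "\<And>z. cmod z < 1 \<Longrightarrow> cmod (g z) \<le> B"
    using bounded_holomorphicE[OF g] by metis
  have hol: "g holomorphic_on unit_disk" using g by (simp add: bounded_holomorphic_def)
  obtain l where l: "l holomorphic_on unit_disk" "\<And>z. z \<in> unit_disk \<Longrightarrow> g z = exp (l z)"
    using contractible_imp_holomorphic_log[OF hol convex_imp_contractible nz] by auto
  have ln_g: "ln (cmod (g z)) = Re (l z)" if "cmod z < 1" for z
    using l(2)[of z] that by simp
  have nonneg: "0 \<le> ln B - Re (l z)" if "cmod z < 1" for z
  proof -
    have "cmod (g z) > 0" using nz that by simp
    then show ?thesis
      unfolding ln_g[OF that, symmetric] using B(1) B(2)[OF that] by (subst diff_ge_0_iff_ge, subst ln_le_cancel_iff) auto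
  qed
  have cont: "continuous_on unit_circle (\<lambda>\<zeta>. l (complex_of_real (r j) * \<zeta>))" for j
    by (intro dilation_continuous_on_circle holomorphic_on_imp_continuous_on l r)
  let ?u = "\<lambda>j (\<zeta>::complex). ln B - Re (l (complex_of_real (r j) * \<zeta>))"
  have int: "integrable arc_length (?u j)" for j
    by (intro integrable_arc_length_continuous continuous_intros cont)
  have mean: "(\<integral>\<zeta>. ?u j \<zeta> \<partial>arc_length) = 2 * pi * (ln B - Re (l 0))" for j
  proof -
    have "(\<integral>\<zeta>. l (r j * \<zeta>) \<partial>arc_length) = 2 * pi * l 0"
    proof (cases "r j = 0")
      case False
      then show ?thesis
        using mean_value_arc_length[OF dilation_holomorphic[OF l(1), of "r j"]] r(1,2)[of j] by simp
    qed (simp add: scaleR_conv_of_real)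
    then have "(\<integral>\<zeta>. Re (l (r j * \<zeta>)) \<partial>arc_length) = 2 * pi * Re (l 0)"
      by (subst integral_Re) (auto intro: integrable_arc_length_continuous cont)
    then show ?thesis
      by (subst Bochner_Integration.integral_diff)
         (auto intro!: integrable_arc_length_continuous continuous_intros cont simp: right_diff_distrib)
  qed
  have [measurable]: "?u j \<in> borel_measurable arc_length" for j
    using int by (rule borel_measurable_integrable)
  have "(\<integral>\<^sup>+\<zeta>. ennreal (?u j \<zeta>) \<partial>arc_length) = ennreal (2 * pi * (ln B - Re (l 0)))" for j
    unfolding mean[of j, symmetric] using r
    by (intro nn_integral_eq_integral int AE_I2 nonneg) (auto simp: space_arc_length norm_mult)
  moreover have "(\<integral>\<^sup>+\<zeta>. liminf (\<lambda>j. ennreal (?u j \<zeta>)) \<partial>arc_length) \<le>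
      liminf (\<lambda>j. \<integral>\<^sup>+\<zeta>. ennreal (?u j \<zeta>) \<partial>arc_length)"
    by (rule nn_integral_liminf) simp
  ultimately have "(\<integral>\<^sup>+\<zeta>. liminf (\<lambda>j. ennreal (?u j \<zeta>)) \<partial>arc_length) \<noteq> \<infinity>"
    by (auto simp: Liminf_const top_unique)
  then have "AE \<zeta> in arc_length. liminf (\<lambda>j. ennreal (?u j \<zeta>)) \<noteq> \<infinity>"
    by (intro nn_integral_PInf_AE) auto
  then show ?thesis
  proof (rule AE_mp, intro AE_I2 impI notI)
    fix \<zeta> assume \<zeta>: "\<zeta> \<in> space arc_length" and fin: "liminf (\<lambda>j. ennreal (?u j \<zeta>)) \<noteq> \<infinity>"
      and lim: "(\<lambda>j. g (complex_of_real (r j) * \<zeta>)) \<longlonglongrightarrow> 0"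
    have in_disk: "cmod (r j * \<zeta>) < 1" for j using r \<zeta> by (simp add: space_arc_length norm_mult)
    have "filterlim (\<lambda>j. cmod (g (r j * \<zeta>))) (at_right 0) sequentially"
      using tendsto_norm[OF lim] nz in_disk
      by (auto simp: filterlim_at)
    then have "filterlim (\<lambda>j. ln (cmod (g (r j * \<zeta>)))) at_bot sequentially"
      by (rule filterlim_compose[OF ln_at_0])
    then have bot: "filterlim (\<lambda>j. Re (l (r j * \<zeta>))) at_bot sequentially"
      using in_disk by (simp add: ln_g)
    obtain x where x: "x \<ge> 0" "liminf (\<lambda>j. ennreal (?u j \<zeta>)) = ennreal x"
      using fin by (cases "liminf (\<lambda>j. ennreal (?u j \<zeta>))") auto
    have "eventually (\<lambda>j. Re (l (r j * \<zeta>)) \<le> ln B - (x + 1)) sequentially"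
      using bot by (auto simp: filterlim_at_bot)
    then have "eventually (\<lambda>j. ennreal (x + 1) \<le> ennreal (?u j \<zeta>)) sequentially"
      by eventually_elim (auto intro: ennreal_leI)
    then have "ennreal (x + 1) \<le> liminf (\<lambda>j. ennreal (?u j \<zeta>))"
      by (rule Liminf_bounded)
    with x show False by (simp add: ennreal_le_iff)
  qed
qed

section \<open>Uniform integrability and convergence\<close>

lemma uniformly_integrable_tail:
  assumes "uniformly_integrable M G" and "0 < (e :: ennreal)"
  shows "\<exists>t>0. \<forall>g\<in>G. (\<integral>\<^sup>+x\<in>{x \<in> space M. norm (g x) \<ge> t}. ennreal (norm (g x)) \<partial>M) \<le> e"
proof -
  let ?I = "\<lambda>t g. \<integral>\<^sup>+x\<in>{x \<in> space M. norm (g x) \<ge> t}. ennreal (norm (g x)) \<partial>M"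
  have "((\<lambda>t. SUP g\<in>G. ?I t g) \<longlongrightarrow> 0) at_top"
    using assms by (simp add: uniformly_integrable_def)
  then have "eventually (\<lambda>t. (SUP g\<in>G. ?I t g) < e) at_top"
    using assms(2) by (rule order_tendstoD)
  then have "eventually (\<lambda>t. t > 0 \<and> (SUP g\<in>G. ?I t g) < e) at_top"
    by (intro eventually_conj eventually_gt_at_top)
  from eventually_happens'[OF trivial_limit_at_top_linorder this]
  obtain t where t: "t > 0" "(SUP g\<in>G. ?I t g) < e" by (elim exE conjE)
  have "?I t g \<le> e" if "g \<in> G" for g
    using SUP_upper[OF that, of "?I t"] t(2) by (rule order_trans[OF _ less_imp_le])
  with t(1) show ?thesis by (intro exI[of _ t] conjI ballI)
qed

text \<open>
  Vitali's convergence theorem, by truncation at a level \<open>t\<close>: the truncated functions converge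
  by dominated convergence, and the truncation error is uniformly small by uniform
  integrability, for the limit as well by Fatou's lemma.
\<close>

lemma vitali_convergence:
  fixes g :: "nat \<Rightarrow> 'a \<Rightarrow> real"
  assumes M: "finite_measure M"
    and ui: "uniformly_integrable M (range g)"
    and k [measurable]: "k \<in> borel_measurable M"
    and lim: "AE x in M. (\<lambda>j. g j x) \<longlonglongrightarrow> k x"
  shows "integrable M (g j)" and "integrable M k"
    and "(\<lambda>j. \<integral>\<^sup>+x. ennreal (norm (g j x - k x)) \<partial>M) \<longlonglongrightarrow> 0"
proof -
  interpret finite_measure M by (rule M)
  define T where "T t x = max (- t) (min x t)" for t x :: real
  have T_cont: "continuous_on UNIV (T t)" for t
    unfolding T_def by (intro continuous_intros)
  have [measurable]: "T t \<in> borel_measurable borel" for t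
    by (intro borel_measurable_continuous_onI T_cont)
  have T_bound: "norm (T t x) \<le> t" if "t > 0" for t x
    using that by (auto simp: T_def)
  have [measurable]: "g j \<in> borel_measurable M" for j
    by (rule bspec[OF conjunct1[OF ui[unfolded uniformly_integrable_def]]]) (rule rangeI)
  have tail: "\<exists>t>0. (\<forall>j. (\<integral>\<^sup>+x. ennreal (norm (g j x - T t (g j x))) \<partial>M) \<le> e) \<and>
      (\<integral>\<^sup>+x. ennreal (norm (k x - T t (k x))) \<partial>M) \<le> e" if e: "e > 0" for e :: ennreal
  proof -
    obtain t where t: "t > 0" and tail_le: "\<forall>h\<in>range g.
        (\<integral>\<^sup>+x\<in>{x \<in> space M. norm (h x) \<ge> t}. ennreal (norm (h x)) \<partial>M) \<le> e"
      using uniformly_integrable_tail[OF ui e] by (elim exE conjE)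
    note le = tail_le[THEN bspec, OF rangeI]
    have A: "(\<integral>\<^sup>+x. ennreal (norm (g j x - T t (g j x))) \<partial>M) \<le> e" for j
    proof (rule order_trans[OF nn_integral_mono le])
      show "ennreal (norm (g j x - T t (g j x))) \<le>
          ennreal (norm (g j x)) * indicator {x \<in> space M. norm (g j x) \<ge> t} x" if "x \<in> space M" for x
        using that t by (auto simp: T_def indicator_def max_def min_def split: if_splits)
    qed
    have "(\<integral>\<^sup>+x. ennreal (norm (k x - T t (k x))) \<partial>M) =
        (\<integral>\<^sup>+x. liminf (\<lambda>j. ennreal (norm (g j x - T t (g j x)))) \<partial>M)"
      using lim
    proof (intro nn_integral_cong_AE, elim AE_mp, intro AE_I2 impI)
      fix x assume "(\<lambda>j. g j x) \<longlonglongrightarrow> k x"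
      then have "(\<lambda>j. ennreal (norm (g j x - T t (g j x)))) \<longlonglongrightarrow> ennreal (norm (k x - T t (k x)))"
        unfolding T_def by (intro tendsto_intros)
      then show "ennreal (norm (k x - T t (k x))) = liminf (\<lambda>j. ennreal (norm (g j x - T t (g j x))))"
        by (rule lim_imp_Liminf[OF trivial_limit_sequentially, symmetric])
    qed
    also have "\<dots> \<le> liminf (\<lambda>j. \<integral>\<^sup>+x. ennreal (norm (g j x - T t (g j x))) \<partial>M)"
      by (rule nn_integral_liminf) measurable
    also have "\<dots> \<le> e"
      using Liminf_mono[of "\<lambda>j. \<integral>\<^sup>+x. ennreal (norm (g j x - T t (g j x))) \<partial>M" "\<lambda>_. e" sequentially] A
      by (simp add: Liminf_const)
    finally show ?thesis using t A by blast
  qed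
  have int: "integrable M h" if [measurable]: "h \<in> borel_measurable M" and t: "t > 0"
    and h: "(\<integral>\<^sup>+x. ennreal (norm (h x - T t (h x))) \<partial>M) \<le> 1" for h t
  proof (rule integrableI_bounded)
    have "(\<integral>\<^sup>+x. ennreal (norm (h x)) \<partial>M) \<le> (\<integral>\<^sup>+x. ennreal t + ennreal (norm (h x - T t (h x))) \<partial>M)"
    proof (rule nn_integral_mono)
      fix x
      have "norm (h x) \<le> t + norm (h x - T t (h x))" using T_bound[OF t, of "h x"] by simp
      then show "ennreal (norm (h x)) \<le> ennreal t + ennreal (norm (h x - T t (h x)))"
        using t by (simp add: ennreal_leI flip: ennreal_plus)
    qed
    also have "\<dots> = ennreal t * emeasure M (space M) + (\<integral>\<^sup>+x. ennreal (norm (h x - T t (h x))) \<partial>M)"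
      by (subst nn_integral_add) auto
    also have "\<dots> < \<infinity>"
      using h emeasure_finite[of "space M"]
      by (auto simp: less_top[symmetric] ennreal_mult_eq_top_iff top_unique)
    finally show "(\<integral>\<^sup>+x. ennreal (norm (h x)) \<partial>M) < \<infinity>" .
  qed fact
  show int_g: "integrable M (g j)" for j
    using tail[of 1] int[of "g j"] by auto
  show int_k: "integrable M k"
    using tail[of 1] int[of k] by auto
  show "(\<lambda>j. \<integral>\<^sup>+x. ennreal (norm (g j x - k x)) \<partial>M) \<longlonglongrightarrow> 0"
  proof (rule order_tendstoI)
    fix e :: ennreal assume "0 < e"
    then obtain d :: ennreal where d: "0 < d" "d + d + d < e"
    proof -
      obtain b where b: "0 < b" "ennreal b < e" 
        using \<open>0 < e\<close> by (metis dense ennreal_cases ennreal_less_zero_iff less_top_ennreal order_less_trans top.not_eq_extremum)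
      show thesis
        by (rule that[of "ennreal (b / 3)"]) (use b in \<open>auto simp flip: ennreal_plus\<close>)
    qed
    obtain t where t: "t > 0" and tg: "\<And>j. (\<integral>\<^sup>+x. ennreal (norm (g j x - T t (g j x))) \<partial>M) \<le> d"
      and tk: "(\<integral>\<^sup>+x. ennreal (norm (k x - T t (k x))) \<partial>M) \<le> d"
      using tail[OF d(1)] by blast
    have "(\<lambda>j. \<integral>\<^sup>+x. ennreal (norm (T t (k x) - T t (g j x))) \<partial>M) \<longlonglongrightarrow> 0"
    proof (rule nn_integral_dominated_convergence_norm[where w = "\<lambda>_. t"])
      show "AE x in M. (\<lambda>j. T t (g j x)) \<longlonglongrightarrow> T t (k x)"
        using lim by eventually_elim (auto simp: T_def intro!: tendsto_intros)
    qed (use t T_bound in \<open>auto simp: ennreal_mult_eq_top_iff less_top[symmetric]\<close>)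
    then have "eventually (\<lambda>j. (\<integral>\<^sup>+x. ennreal (norm (T t (k x) - T t (g j x))) \<partial>M) < d) sequentially"
      using d(1) by (rule order_tendstoD)
    then show "eventually (\<lambda>j. (\<integral>\<^sup>+x. ennreal (norm (g j x - k x)) \<partial>M) < e) sequentially"
    proof eventually_elim
      case (elim j)
      have "(\<integral>\<^sup>+x. ennreal (norm (g j x - k x)) \<partial>M) \<le>
          (\<integral>\<^sup>+x. ennreal (norm (g j x - T t (g j x))) + ennreal (norm (T t (k x) - T t (g j x))) +
             ennreal (norm (k x - T t (k x))) \<partial>M)"
        by (intro nn_integral_mono) (auto simp flip: ennreal_plus intro!: ennreal_leI)
      also have "\<dots> = (\<integral>\<^sup>+x. ennreal (norm (g j x - T t (g j x))) \<partial>M) +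
          (\<integral>\<^sup>+x. ennreal (norm (T t (k x) - T t (g j x))) \<partial>M) + (\<integral>\<^sup>+x. ennreal (norm (k x - T t (k x))) \<partial>M)"
        by (simp add: nn_integral_add)
      also have "\<dots> \<le> d + d + d"
        using tg[of j] elim tk by (intro add_mono) auto
      finally show ?case using d(2) by simp
    qed
  qed simp
qed

lemma log_plus_eq: "0 \<le> x \<Longrightarrow> log_plus x = ln (max 1 x)"
  by (auto simp: log_plus_def max_def not_le)

lemma log_plus_nonneg: "0 \<le> log_plus x"
  by (simp add: log_plus_def)

lemma le_exp_log_plus: "x \<le> exp (log_plus x)"
proof (cases "x > 0")
  case True
  then have "x = exp (ln x)" by simp
  also have "\<dots> \<le> exp (log_plus x)" using True by (subst exp_le_cancel_iff) (simp add: log_plus_def)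
  finally show ?thesis .
qed (use exp_gt_zero[of "log_plus x"] in linarith)

lemma continuous_on_log_plus: "continuous_on {0..} log_plus"
proof -
  have "continuous_on {0..} (\<lambda>x. ln (max 1 (x::real)))"
    by (intro continuous_intros) auto
  then show ?thesis
    by (rule continuous_on_eq) (simp add: log_plus_eq)
qed

text \<open>
  For fixed \<open>z\<close> the Poisson kernel is bounded.
\<close>

lemma Re_herglotz_tendsto_L1:
  assumes g: "\<And>j. integrable arc_length (g j)" and k: "integrable arc_length k"
    and lim: "(\<lambda>j. \<integral>\<^sup>+\<zeta>. ennreal (norm (g j \<zeta> - k \<zeta>)) \<partial>arc_length) \<longlonglongrightarrow> 0"
    and z: "cmod z < 1"
  shows "(\<lambda>j. Re (herglotz (g j) z)) \<longlonglongrightarrow> Re (herglotz k z)"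
proof -
  define C where "C = (1 + cmod z) / (1 - cmod z)"
  have C: "0 \<le> poisson_kernel z \<zeta> \<and> poisson_kernel z \<zeta> \<le> C" if "\<zeta> \<in> unit_circle" for \<zeta>
    using poisson_kernel_nonneg[OF z that] poisson_kernel_le[OF _ z that] by (simp add: C_def)
  have [measurable]: "g j \<in> borel_measurable arc_length" "k \<in> borel_measurable arc_length" for j
    using g k by auto
  have "(\<lambda>j. \<integral>\<zeta>. poisson_kernel z \<zeta> * g j \<zeta> \<partial>arc_length) \<longlonglongrightarrow> (\<integral>\<zeta>. poisson_kernel z \<zeta> * k \<zeta> \<partial>arc_length)"
  proof (rule tendsto_L1_int)
    show "(\<lambda>j. \<integral>\<^sup>+\<zeta>. ennreal (norm (poisson_kernel z \<zeta> * g j \<zeta> - poisson_kernel z \<zeta> * k \<zeta>)) \<partial>arc_length) \<longlonglongrightarrow> 0"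
    proof (rule tendsto_sandwich[OF _ _ tendsto_const])
      have "(\<lambda>j. ennreal C * (\<integral>\<^sup>+\<zeta>. ennreal (norm (g j \<zeta> - k \<zeta>)) \<partial>arc_length)) \<longlonglongrightarrow> ennreal C * 0"
        by (intro ennreal_tendsto_cmult lim) simp
      then show "(\<lambda>j. ennreal C * (\<integral>\<^sup>+\<zeta>. ennreal (norm (g j \<zeta> - k \<zeta>)) \<partial>arc_length)) \<longlonglongrightarrow> 0" by simp
      show "eventually (\<lambda>j. (\<integral>\<^sup>+\<zeta>. ennreal (norm (poisson_kernel z \<zeta> * g j \<zeta> - poisson_kernel z \<zeta> * k \<zeta>)) \<partial>arc_length)
          \<le> ennreal C * (\<integral>\<^sup>+\<zeta>. ennreal (norm (g j \<zeta> - k \<zeta>)) \<partial>arc_length)) sequentially"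
      proof (intro always_eventually allI)
        fix j
        have "(\<integral>\<^sup>+\<zeta>. ennreal (norm (poisson_kernel z \<zeta> * g j \<zeta> - poisson_kernel z \<zeta> * k \<zeta>)) \<partial>arc_length)
            \<le> (\<integral>\<^sup>+\<zeta>. ennreal C * ennreal (norm (g j \<zeta> - k \<zeta>)) \<partial>arc_length)"
        proof (rule nn_integral_mono)
          fix \<zeta> assume "\<zeta> \<in> space arc_length"
          then have "0 \<le> poisson_kernel z \<zeta>" "poisson_kernel z \<zeta> \<le> C"
            using C by (auto simp: space_arc_length)
          then show "ennreal (norm (poisson_kernel z \<zeta> * g j \<zeta> - poisson_kernel z \<zeta> * k \<zeta>))
              \<le> ennreal C * ennreal (norm (g j \<zeta> - k \<zeta>))"
            by (subst ennreal_mult[symmetric])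
               (auto intro!: ennreal_leI mult_right_mono simp: abs_mult simp flip: right_diff_distrib)
        qed
        also have "\<dots> = ennreal C * (\<integral>\<^sup>+\<zeta>. ennreal (norm (g j \<zeta> - k \<zeta>)) \<partial>arc_length)"
          by (rule nn_integral_cmult) measurable
        finally show "(\<integral>\<^sup>+\<zeta>. ennreal (norm (poisson_kernel z \<zeta> * g j \<zeta> - poisson_kernel z \<zeta> * k \<zeta>)) \<partial>arc_length)
            \<le> ennreal C * (\<integral>\<^sup>+\<zeta>. ennreal (norm (g j \<zeta> - k \<zeta>)) \<partial>arc_length)" .
      qed
    qed simp
  qed (intro poisson_kernel_integrable z g k)+
  then show ?thesis
    unfolding Re_herglotz[OF g z] Re_herglotz[OF k z] by (intro tendsto_intros) auto
qed

lemma nevanlinna_imp_holomorphic: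
  assumes "f \<in> nevanlinna"
  shows "f holomorphic_on unit_disk"
proof -
  obtain f1 f2 where f12: "bounded_holomorphic f1" "bounded_holomorphic f2"
    "\<And>z. z \<in> unit_disk \<Longrightarrow> f2 z \<noteq> 0" "\<And>z. z \<in> unit_disk \<Longrightarrow> f z = f1 z / f2 z"
    using assms unfolding nevanlinna_def by blast
  have "f1 holomorphic_on unit_disk" "f2 holomorphic_on unit_disk"
    using f12(1,2) by (auto simp: bounded_holomorphic_def)
  then have "(\<lambda>z. f1 z / f2 z) holomorphic_on unit_disk"
    using f12(3) by (intro holomorphic_intros) auto
  then show ?thesis
    by (rule holomorphic_transform) (simp add: f12(4))
qed

section \<open>From uniform integrability to the Smirnov class\<close>

lemma radial_limit_dilation:
  assumes f: "continuous_on unit_disk f" and r: "0 \<le> r" "r < 1" and \<zeta>: "\<zeta> \<in> unit_circle"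
  shows "radial_limit (f \<circ> (\<lambda>z. complex_of_real r * z)) \<zeta> = f (complex_of_real r * \<zeta>)"
  unfolding radial_limit_def
proof (rule tendsto_Lim)
  have "isCont f (complex_of_real r * \<zeta>)"
    using f r \<zeta> by (intro continuous_on_interior) (auto simp: norm_mult)
  moreover have "((\<lambda>t. complex_of_real r * (complex_of_real t * \<zeta>)) \<longlongrightarrow> complex_of_real r * (complex_of_real 1 * \<zeta>)) (at_left 1)"
    by (intro tendsto_intros)
  ultimately show "((\<lambda>t. (f \<circ> (\<lambda>z. complex_of_real r * z)) (complex_of_real t * \<zeta>)) \<longlongrightarrow> f (complex_of_real r * \<zeta>)) (at_left 1)"
    unfolding o_def by (intro isCont_tendsto_compose[where g = f]) auto
qed simp

lemma uniformly_integrable_subset: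
  assumes "uniformly_integrable M G" "G' \<subseteq> G"
  shows "uniformly_integrable M G'"
  unfolding uniformly_integrable_def
proof
  show "\<forall>g\<in>G'. g \<in> borel_measurable M"
    using assms unfolding uniformly_integrable_def by blast
  have "((\<lambda>t::real. SUP g\<in>G. \<integral>\<^sup>+x\<in>{x \<in> space M. norm (g x) \<ge> t}. ennreal (norm (g x)) \<partial>M) \<longlongrightarrow> 0) at_top"
    using assms(1) unfolding uniformly_integrable_def by (rule conjunct2)
  then show "((\<lambda>t::real. SUP g\<in>G'. \<integral>\<^sup>+x\<in>{x \<in> space M. norm (g x) \<ge> t}. ennreal (norm (g x)) \<partial>M) \<longlongrightarrow> 0) at_top"
    by (rule tendsto_sandwich[OF _ _ tendsto_const, rotated 2])
       (intro always_eventually allI SUP_subset_mono assms(2) order_refl zero_le)+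
qed

text \<open>
  The denominator is the outer function \<open>exp (- H[k])\<close>, with boundary modulus \<open>exp (- k)\<close>. It is
  bounded by 1 since \<open>k \<ge> 0\<close>, and its product with \<open>f\<close> is bounded by 1 by assumption.
\<close>

lemma smirnov_if_log_majorant:
  assumes f: "f \<in> nevanlinna" and k: "integrable arc_length k"
    and nonneg: "\<And>\<zeta>. \<zeta> \<in> unit_circle \<Longrightarrow> 0 \<le> k \<zeta>"
    and le: "\<And>z. cmod z < 1 \<Longrightarrow> cmod (f z) \<le> exp (Re (herglotz k z))"
  shows "f \<in> smirnov"
proof -
  define h where "h z = exp (- herglotz k z)" for z
  have h_hol: "h holomorphic_on unit_disk"
    unfolding h_def by (intro holomorphic_intros herglotz_holomorphic k)
  have fh_hol: "(\<lambda>z. f z * h z) holomorphic_on unit_disk"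
    by (intro holomorphic_intros nevanlinna_imp_holomorphic f h_hol)
  have "cmod (f z * h z) \<le> 1" if "z \<in> unit_disk" for z
  proof -
    have "cmod (f z * h z) \<le> exp (Re (herglotz k z)) * exp (- Re (herglotz k z))"
      using le[of z] that by (simp add: norm_mult h_def mult_right_mono)
    then show ?thesis by (simp flip: exp_add)
  qed
  then have fh: "bounded_holomorphic (\<lambda>z. f z * h z)"
    using fh_hol unfolding bounded_holomorphic_def bounded_iff by blast
  have "cmod (h z) \<le> 1" if "z \<in> unit_disk" for z
  proof -
    have "Re (herglotz (\<lambda>_. 0) z) \<le> Re (herglotz k z)"
      using that nonneg by (intro Re_herglotz_mono k) auto
    then show ?thesis by (simp add: h_def herglotz_def)
  qed
  then have h: "bounded_holomorphic h"
    using h_hol unfolding bounded_holomorphic_def bounded_iff by blast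
  have "outer h"
    unfolding outer_def
  proof (intro conjI h_hol exI[of _ "1::complex"] exI[of _ "\<lambda>\<zeta>. exp (- k \<zeta>)"] ballI)
    show "integrable arc_length (\<lambda>\<zeta>. ln (exp (- k \<zeta>)))" using k by simp
    show "h z = 1 * exp ((\<integral>\<zeta>. (\<zeta> + z) / (\<zeta> - z) * complex_of_real (ln (exp (- k \<zeta>))) \<partial>arc_length) / (2 * pi))" for z
      unfolding h_def herglotz_minus[symmetric] by (simp add: herglotz_def)
  qed auto
  moreover have "f z = (f z * h z) / h z" for z
    by (simp add: h_def)
  ultimately show ?thesis
    using f fh h unfolding smirnov_def by blast
qed

text \<open>
  The majorant is the boundary function \<open>k\<close> of \<open>log\<^sup>+ |f|\<close>, constructed as the limit along a
  sequence of dilations.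
\<close>

lemma smirnov_if_uniformly_integrable:
  assumes f: "f \<in> nevanlinna" and a: "0 \<le> a"
    and ui: "uniformly_integrable arc_length
      {(\<lambda>\<zeta>. log_plus (cmod (radial_limit (f \<circ> \<psi>) \<zeta>))) | \<psi>. \<psi> \<in> schur_class_le a}"
  shows "f \<in> smirnov"
proof -
  obtain f1 f2 where f12: "bounded_holomorphic f1" "bounded_holomorphic f2"
    "\<And>z. z \<in> unit_disk \<Longrightarrow> f2 z \<noteq> 0" "\<And>z. z \<in> unit_disk \<Longrightarrow> f z = f1 z / f2 z"
    using f unfolding nevanlinna_def by blast
  have f_hol: "f holomorphic_on unit_disk"
    by (rule nevanlinna_imp_holomorphic[OF f])
  then have f_cont: "continuous_on unit_disk f"
    by (rule holomorphic_on_imp_continuous_on)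

  \<comment> \<open>A sequence of radii along which the dilations of \<open>f1\<close> and \<open>f2\<close> both converge.\<close>
  define \<rho> where "\<rho> j = 1 - 1 / real (j + 2)" for j
  have \<rho>: "incseq \<rho>" "\<And>j. 0 \<le> \<rho> j" "\<And>j. \<rho> j < 1"
    by (auto simp: \<rho>_def incseq_def field_simps)
  obtain q1 where q1: "strict_mono q1"
    and conv1: "AE \<zeta> in arc_length. convergent (\<lambda>j. f1 (complex_of_real (\<rho> (q1 j)) * \<zeta>))"
    using AE_convergent_subsequence_of_dilations[OF f12(1) \<rho>] .
  have \<rho>1: "incseq (\<lambda>j. \<rho> (q1 j))"
    using \<rho>(1) q1 by (simp add: incseq_def strict_mono_less_eq)
  obtain q2 where q2: "strict_mono q2"
    and conv2: "AE \<zeta> in arc_length. convergent (\<lambda>j. f2 (complex_of_real (\<rho> (q1 (q2 j))) * \<zeta>))"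
    using AE_convergent_subsequence_of_dilations[OF f12(2) \<rho>1 \<rho>(2,3)] .
  define r where "r j = \<rho> (q1 (q2 j))" for j
  have r: "0 \<le> r j" "r j < 1" for j
    using \<rho>(2,3) by (simp_all add: r_def)
  have r_pos: "0 < r j" for j
    by (simp add: r_def \<rho>_def)
  have r_lim: "r \<longlonglongrightarrow> 1"
  proof -
    have "strict_mono (q1 \<circ> q2)" using q1 q2 by (rule strict_mono_o)
    moreover have "\<rho> \<longlonglongrightarrow> 1"
      unfolding \<rho>_def using tendsto_diff[OF tendsto_const LIMSEQ_ignore_initial_segment[OF lim_const_over_n[of 1], of 2], of 1]
      by simp
    ultimately show ?thesis
      using LIMSEQ_subseq_LIMSEQ[of \<rho> 1 "q1 \<circ> q2"] by (simp add: r_def[abs_def] o_def)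
  qed

  define g where "g j \<zeta> = log_plus (cmod (radial_limit (f \<circ> (\<lambda>z. complex_of_real (r j) * z)) \<zeta>))" for j \<zeta>
  have g_eq: "g j \<zeta> = log_plus (cmod (f (complex_of_real (r j) * \<zeta>)))" if "\<zeta> \<in> unit_circle" for j \<zeta>
    unfolding g_def radial_limit_dilation[OF f_cont r that] ..
  have "(\<lambda>z. complex_of_real (r j) * z) \<in> schur_class_le a" for j
  proof -
    have "cmod (complex_of_real (r j) * z) < 1" if "cmod z < 1" for z
    proof -
      have "r j * cmod z \<le> 1 * cmod z" using r[of j] by (intro mult_right_mono) auto
      then show ?thesis using r[of j] that by (simp add: norm_mult)
    qed
    then show ?thesis
      using a by (auto simp: schur_class_le_def schur_class_def intro!: holomorphic_intros)
  qed
  then have ui_g: "uniformly_integrable arc_length (range g)"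
    by (intro uniformly_integrable_subset[OF ui]) (auto simp: g_def[abs_def])
  have g_meas [measurable]: "g j \<in> borel_measurable arc_length" for j
    by (rule bspec[OF conjunct1[OF ui_g[unfolded uniformly_integrable_def]]]) (rule rangeI)

  \<comment> \<open>The maximum ensures \<open>k \<ge> 0\<close> also on the null set where the sequence does not converge.\<close>
  define k where "k \<zeta> = max 0 (lim (\<lambda>j. g j \<zeta>))" for \<zeta>
  have k_nonneg: "0 \<le> k \<zeta>" for \<zeta>
    by (simp add: k_def)
  have k_meas [measurable]: "k \<in> borel_measurable arc_length"
    unfolding k_def by measurable
  have lim2_nonzero: "AE \<zeta> in arc_length. \<not> (\<lambda>j. f2 (complex_of_real (r j) * \<zeta>)) \<longlonglongrightarrow> 0"
    using f12(3) r by (intro AE_lim_dilations_nonzero f12(2)) auto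
  have g_lim: "AE \<zeta> in arc_length. (\<lambda>j. g j \<zeta>) \<longlonglongrightarrow> k \<zeta>"
    using conv1 conv2 lim2_nonzero AE_space
  proof eventually_elim
    case (elim \<zeta>)
    then have \<zeta>: "\<zeta> \<in> unit_circle" by (simp add: space_arc_length)
    obtain l1 where "(\<lambda>j. f1 (complex_of_real (\<rho> (q1 j)) * \<zeta>)) \<longlonglongrightarrow> l1"
      using elim(1) by (auto simp: convergent_def)
    then have l1: "(\<lambda>j. f1 (complex_of_real (r j) * \<zeta>)) \<longlonglongrightarrow> l1"
      using LIMSEQ_subseq_LIMSEQ[OF _ q2] by (auto simp: r_def o_def)
    obtain l2 where l2: "(\<lambda>j. f2 (complex_of_real (r j) * \<zeta>)) \<longlonglongrightarrow> l2"
      using elim(2) by (auto simp: convergent_def r_def)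
    have "l2 \<noteq> 0" using elim(3) l2 by auto
    have in_disk: "complex_of_real (r j) * \<zeta> \<in> unit_disk" for j
      using r[of j] \<zeta> by (simp add: norm_mult)
    have "(\<lambda>j. f (complex_of_real (r j) * \<zeta>)) \<longlonglongrightarrow> l1 / l2"
      unfolding f12(4)[OF in_disk] using l1 l2 \<open>l2 \<noteq> 0\<close> by (rule tendsto_divide)
    then have "(\<lambda>j. log_plus (cmod (f (complex_of_real (r j) * \<zeta>)))) \<longlonglongrightarrow> log_plus (cmod (l1 / l2))"
      by (intro continuous_on_tendsto_compose[OF continuous_on_log_plus] tendsto_norm) auto
    then have "(\<lambda>j. g j \<zeta>) \<longlonglongrightarrow> log_plus (cmod (l1 / l2))"
      by (simp add: g_eq[OF \<zeta>])
    moreover from limI[OF this] have "k \<zeta> = log_plus (cmod (l1 / l2))"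
      by (simp add: k_def log_plus_nonneg)
    ultimately show ?case by simp
  qed
  note vitali = vitali_convergence[OF finite_measure_arc_length ui_g k_meas g_lim]

  have "cmod (f z) \<le> exp (Re (herglotz k z))" if z: "cmod z < 1" for z
  proof -
    have cont: "continuous_on unit_circle (\<lambda>\<zeta>. log_plus (cmod (f (complex_of_real (r j) * \<zeta>))))" for j
      by (intro continuous_on_compose2[OF continuous_on_log_plus] continuous_on_norm
            dilation_continuous_on_circle f_cont r) auto
    have le: "cmod (f (complex_of_real (r j) * z)) \<le> exp (Re (herglotz (g j) z))" for j
    proof -
      have "cmod (f (complex_of_real (r j) * z)) \<le>
          exp (Re (herglotz (\<lambda>\<zeta>. log_plus (cmod (f (complex_of_real (r j) * \<zeta>)))) z))"
        using r_pos[of j] r[of j]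
        by (intro cmod_le_exp_herglotz[OF dilation_holomorphic[OF f_hol, of "r j"]] cont le_exp_log_plus z) auto
      also have "herglotz (\<lambda>\<zeta>. log_plus (cmod (f (complex_of_real (r j) * \<zeta>)))) z = herglotz (g j) z"
        unfolding herglotz_def
        by (intro arg_cong2[where f = "(/)"] Bochner_Integration.integral_cong refl) (simp add: space_arc_length g_eq)
      finally show ?thesis .
    qed
    have "isCont f z"
      using f_cont z by (intro continuous_on_interior) auto
    moreover have "(\<lambda>j. complex_of_real (r j) * z) \<longlonglongrightarrow> complex_of_real 1 * z"
      by (intro tendsto_intros r_lim)
    ultimately have "(\<lambda>j. cmod (f (complex_of_real (r j) * z))) \<longlonglongrightarrow> cmod (f z)"
      by (intro tendsto_norm isCont_tendsto_compose[where g = f]) auto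
    moreover have "(\<lambda>j. exp (Re (herglotz (g j) z))) \<longlonglongrightarrow> exp (Re (herglotz k z))"
      by (intro tendsto_exp Re_herglotz_tendsto_L1 vitali z)
    ultimately show ?thesis
      using le by (intro tendsto_le[OF trivial_limit_sequentially]) auto
  qed
  then show ?thesis
    by (intro smirnov_if_log_majorant[OF f vitali(2)] k_nonneg)
qed

section \<open>Measurability of radial limits\<close>

text \<open>
  Reduces bounds on real arguments to rational ones, so that only countably many conditions are
  left.
\<close>

lemma dist_le_if_rational_dist_le:
  fixes \<phi> :: "real \<Rightarrow> 'a::metric_space"
  assumes cont: "continuous_on {a<..<b} \<phi>"
    and le: "\<And>t::rat. of_rat t \<in> {a<..<b} \<Longrightarrow> dist (\<phi> (of_rat t)) p \<le> c"
    and s: "s \<in> {a<..<b}"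
  shows "dist (\<phi> s) p \<le> c"
proof (rule ccontr)
  assume "\<not> dist (\<phi> s) p \<le> c"
  then have "c < dist (\<phi> s) p" by simp
  moreover have "isCont \<phi> s"
    using cont s by (simp add: continuous_on_eq_continuous_at)
  then have "((\<lambda>t. dist (\<phi> t) p) \<longlongrightarrow> dist (\<phi> s) p) (at s)"
    by (intro tendsto_dist tendsto_const) (simp add: isCont_def)
  ultimately have "eventually (\<lambda>t. c < dist (\<phi> t) p) (at s)"
    by (simp add: order_tendstoD(1))
  then have "eventually (\<lambda>t. c < dist (\<phi> t) p) (at_right s)"
    using filter_leD[OF at_le[OF subset_UNIV]] by blast
  then obtain b' where b': "b' > s" "\<And>t. s < t \<Longrightarrow> t < b' \<Longrightarrow> c < dist (\<phi> t) p"
    unfolding eventually_at_right_field by blast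
  obtain t where "s < of_rat t" "of_rat t < min b b'"
    using of_rat_dense[of s "min b b'"] b'(1) s by auto
  then show False using b'(2)[of "of_rat t"] le[of t] s by fastforce
qed

text \<open>
  The right-hand side involves only countable quantifiers, so it describes a measurable set when
  \<open>\<phi>\<close> depends measurably on a parameter.
\<close>

lemma ex_left_limit_iff_rational_Cauchy:
  fixes \<phi> :: "real \<Rightarrow> 'a::complete_space"
  assumes cont: "continuous_on {0..<1} \<phi>"
  shows "(\<exists>l. (\<phi> \<longlongrightarrow> l) (at_left 1)) \<longleftrightarrow>
    (\<forall>m::nat. \<exists>N::nat. \<forall>s::rat. \<forall>t::rat. of_rat s \<in> {1 - 1 / (real N + 1)<..<1} \<longrightarrow>
       of_rat t \<in> {1 - 1 / (real N + 1)<..<1} \<longrightarrow>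
       dist (\<phi> (of_rat s)) (\<phi> (of_rat t)) \<le> 1 / (real m + 1))"
    (is "?L \<longleftrightarrow> ?R")
proof
  assume ?L
  then obtain l where l: "(\<phi> \<longlongrightarrow> l) (at_left 1)" ..
  show ?R
  proof
    fix m :: nat
    have "eventually (\<lambda>t. dist (\<phi> t) l < 1 / (2 * (real m + 1))) (at_left 1)"
      using l by (rule tendstoD) simp
    then obtain b where b: "b < 1" "\<And>t. b < t \<Longrightarrow> t < 1 \<Longrightarrow> dist (\<phi> t) l < 1 / (2 * (real m + 1))"
      unfolding eventually_at_left_field by blast
    obtain N where N: "1 / (real N + 1) < 1 - b"
      using reals_Archimedean[of "1 - b"] b(1) by (auto simp: inverse_eq_divide add.commute)
    have "dist (\<phi> s) (\<phi> t) \<le> 1 / (real m + 1)"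
      if "s \<in> {1 - 1 / (real N + 1)<..<1}" "t \<in> {1 - 1 / (real N + 1)<..<1}" for s t
    proof -
      have "dist (\<phi> s) (\<phi> t) \<le> dist (\<phi> s) l + dist (\<phi> t) l"
        by (rule dist_triangle2)
      also have "\<dots> \<le> 1 / (2 * (real m + 1)) + 1 / (2 * (real m + 1))"
        using b(2)[of s] b(2)[of t] that N by (intro add_mono) auto
      also have "\<dots> = 1 / (real m + 1)" by (simp add: field_simps)
      finally show ?thesis .
    qed
    then show "\<exists>N::nat. \<forall>s::rat. \<forall>t::rat. of_rat s \<in> {1 - 1 / (real N + 1)<..<1} \<longrightarrow>
       of_rat t \<in> {1 - 1 / (real N + 1)<..<1} \<longrightarrow>
       dist (\<phi> (of_rat s)) (\<phi> (of_rat t)) \<le> 1 / (real m + 1)"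
      by blast
  qed
next
  assume R: ?R
  have C: "\<exists>N::nat. \<forall>s\<in>{1 - 1 / (real N + 1)<..<1}. \<forall>t\<in>{1 - 1 / (real N + 1)<..<1}.
      dist (\<phi> s) (\<phi> t) \<le> 1 / (real m + 1)" for m :: nat
  proof -
    obtain N :: nat where N: "\<And>s t :: rat. of_rat s \<in> {1 - 1 / (real N + 1)<..<1} \<Longrightarrow>
       of_rat t \<in> {1 - 1 / (real N + 1)<..<1} \<Longrightarrow> dist (\<phi> (of_rat s)) (\<phi> (of_rat t)) \<le> 1 / (real m + 1)"
      using R by blast
    let ?I = "{1 - 1 / (real N + 1)<..<1}"
    have c: "continuous_on ?I \<phi>"
      by (rule continuous_on_subset[OF cont])
         (simp add: greaterThanLessThan_subseteq_atLeastLessThan_iff)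
    have "dist (\<phi> s) (\<phi> t) \<le> 1 / (real m + 1)" if s: "s \<in> ?I" and t: "t \<in> ?I" for s t
    proof (rule dist_le_if_rational_dist_le[OF c _ s])
      fix s' :: rat assume s': "of_rat s' \<in> ?I"
      have "dist (\<phi> t) (\<phi> (of_rat s')) \<le> 1 / (real m + 1)"
        by (rule dist_le_if_rational_dist_le[OF c _ t]) (rule N[OF _ s'])
      then show "dist (\<phi> (of_rat s')) (\<phi> t) \<le> 1 / (real m + 1)" by (simp add: dist_commute)
    qed
    then show ?thesis by blast
  qed
  define r where "r j = 1 - 1 / (real j + 2)" for j :: nat
  have r: "r j \<in> {1 - 1 / (real N + 1)<..<1}" if "j \<ge> N" for j N
    using that by (auto simp: r_def field_simps)
  have "Cauchy (\<lambda>j. \<phi> (r j))"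
  proof (rule metric_CauchyI)
    fix e :: real assume "e > 0"
    then obtain m where m: "1 / (real m + 1) < e"
      using reals_Archimedean[of e] by (auto simp: inverse_eq_divide add.commute)
    obtain N :: nat where N: "\<forall>s\<in>{1 - 1 / (real N + 1)<..<1}. \<forall>t\<in>{1 - 1 / (real N + 1)<..<1}.
        dist (\<phi> s) (\<phi> t) \<le> 1 / (real m + 1)"
      using C by blast
    show "\<exists>N. \<forall>i\<ge>N. \<forall>j\<ge>N. dist (\<phi> (r i)) (\<phi> (r j)) < e"
    proof (intro exI[of _ N] allI impI)
      fix i j assume "i \<ge> N" "j \<ge> N"
      then have "dist (\<phi> (r i)) (\<phi> (r j)) \<le> 1 / (real m + 1)" using N r by blast
      then show "dist (\<phi> (r i)) (\<phi> (r j)) < e" using m by simp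
    qed
  qed
  then obtain l where l: "(\<lambda>j. \<phi> (r j)) \<longlonglongrightarrow> l"
    by (auto simp: Cauchy_convergent_iff convergent_def)
  have "(\<phi> \<longlongrightarrow> l) (at_left 1)"
  proof (rule tendstoI)
    fix e :: real assume "e > 0"
    then obtain m where m: "1 / (real m + 1) < e"
      using reals_Archimedean[of e] by (auto simp: inverse_eq_divide add.commute)
    obtain N :: nat where N: "\<forall>s\<in>{1 - 1 / (real N + 1)<..<1}. \<forall>t\<in>{1 - 1 / (real N + 1)<..<1}.
        dist (\<phi> s) (\<phi> t) \<le> 1 / (real m + 1)"
      using C by blast
    have "dist (\<phi> t) l < e" if t: "t \<in> {1 - 1 / (real N + 1)<..<1}" for t
    proof -
      have "(\<lambda>j. dist (\<phi> t) (\<phi> (r j))) \<longlonglongrightarrow> dist (\<phi> t) l"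
        by (intro tendsto_intros l)
      moreover have "eventually (\<lambda>j. dist (\<phi> t) (\<phi> (r j)) \<le> 1 / (real m + 1)) sequentially"
        using eventually_ge_at_top[of N] by eventually_elim (use N t r in \<open>blast\<close>)
      ultimately have "dist (\<phi> t) l \<le> 1 / (real m + 1)"
        by (intro tendsto_upperbound) auto
      with m show ?thesis by simp
    qed
    then show "eventually (\<lambda>t. dist (\<phi> t) l < e) (at_left 1)"
      unfolding eventually_at_left_field
      by (intro exI[of _ "1 - 1 / (real N + 1)"] conjI allI impI) simp_all
  qed
  then show ?L ..
qed

text \<open>
  The value of \<open>Lim\<close>, hence of \<open>radial_limit\<close>, where there is no limit.
\<close>

definition no_limit :: complex where
  "no_limit = (THE l. False)"

lemma radial_limit_cases:
  obtains (limit) "((\<lambda>t. g (complex_of_real t * \<zeta>)) \<longlongrightarrow> radial_limit g \<zeta>) (at_left 1)"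
  | (no_limit) "\<nexists>l. ((\<lambda>t. g (complex_of_real t * \<zeta>)) \<longlongrightarrow> l) (at_left 1)" "radial_limit g \<zeta> = no_limit"
proof (cases "\<exists>l. ((\<lambda>t. g (complex_of_real t * \<zeta>)) \<longlongrightarrow> l) (at_left 1)")
  case True
  then obtain l where "((\<lambda>t. g (complex_of_real t * \<zeta>)) \<longlongrightarrow> l) (at_left 1)" ..
  moreover from this have "radial_limit g \<zeta> = l"
    unfolding radial_limit_def by (intro tendsto_Lim) auto
  ultimately show thesis
    using limit by simp
next
  case False
  then show thesis
    by (intro no_limit) (auto simp: radial_limit_def Topological_Spaces.Lim_def no_limit_def)
qed

lemma radial_limit_tendsto_seq:
  assumes "((\<lambda>t. g (complex_of_real t * \<zeta>)) \<longlongrightarrow> l) (at_left 1)"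
  shows "(\<lambda>j. g (complex_of_real (1 - 1 / (real j + 2)) * \<zeta>)) \<longlonglongrightarrow> l"
proof -
  have "(\<lambda>j. 1 - 1 / (real j + 2)) \<longlonglongrightarrow> 1"
    by real_asymp
  then have "filterlim (\<lambda>j. 1 - 1 / (real j + 2)) (at_left 1) sequentially"
    by (auto simp: filterlim_at)
  from filterlim_compose[OF assms this] show ?thesis .
qed

text \<open>
  On the measurable set where the limit exists it is the limit of a sequence of continuous
  functions; elsewhere the value is constant.
\<close>

lemma radial_limit_measurable:
  assumes cont: "continuous_on unit_disk g"
  shows "radial_limit g \<in> borel_measurable arc_length"
proof -
  \<comment> \<open>The default value 0 makes \<open>G t\<close> measurable for all real \<open>t\<close>.\<close>
  define G where "G t \<zeta> = (if 0 \<le> t \<and> t < 1 then g (complex_of_real t * \<zeta>) else 0)" for t \<zeta>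
  have [measurable]: "G t \<in> borel_measurable arc_length" for t
  proof (cases "0 \<le> t \<and> t < 1")
    case True
    then have "G t = (\<lambda>\<zeta>. g (complex_of_real t * \<zeta>))" by (auto simp: G_def)
    then show ?thesis
      using True by (auto intro!: borel_measurable_arc_length_continuous dilation_continuous_on_circle cont)
  next
    case False
    then have "G t = (\<lambda>\<zeta>. 0)" by (auto simp: G_def)
    then show ?thesis by simp
  qed
  define E where "E \<zeta> \<longleftrightarrow> (\<forall>m::nat. \<exists>N::nat. \<forall>s::rat. \<forall>t::rat. of_rat s \<in> {1 - 1 / (real N + 1)<..<1} \<longrightarrow>
       of_rat t \<in> {1 - 1 / (real N + 1)<..<1} \<longrightarrow>
       dist (G (of_rat s) \<zeta>) (G (of_rat t) \<zeta>) \<le> 1 / (real m + 1))" for \<zeta>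
  have [measurable]: "Measurable.pred arc_length E"
    unfolding E_def by measurable
  have "radial_limit g \<zeta> = (if E \<zeta> then lim (\<lambda>j. G (1 - 1 / (real j + 2)) \<zeta>) else no_limit)"
    if "\<zeta> \<in> space arc_length" for \<zeta>
  proof -
    have \<zeta>: "cmod \<zeta> = 1" using that by (simp add: space_arc_length)
    have cont_ray: "continuous_on {0..<1} (\<lambda>t. g (complex_of_real t * \<zeta>))"
      by (rule continuous_on_compose2[OF cont]) (auto intro!: continuous_intros simp: norm_mult \<zeta>)
    have G_eq: "G t \<zeta> = g (complex_of_real t * \<zeta>)" if "t \<in> {1 - 1 / (real N + 1)<..<1}" for t N
    proof -
      have "0 \<le> 1 - 1 / (real N + 1)" by simp
      moreover have "1 - 1 / (real N + 1) < t" "t < 1"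
        using that unfolding greaterThanLessThan_iff by blast+
      ultimately have "0 \<le> t" by linarith
      with \<open>t < 1\<close> show ?thesis by (simp add: G_def)
    qed
    have E: "E \<zeta> \<longleftrightarrow> (\<exists>l. ((\<lambda>t. g (complex_of_real t * \<zeta>)) \<longlongrightarrow> l) (at_left 1))"
      unfolding E_def ex_left_limit_iff_rational_Cauchy[OF cont_ray]
      by (intro iff_allI iff_exI imp_cong refl) (simp only: G_eq)
    have "(\<lambda>j. G (1 - 1 / (real j + 2)) \<zeta>) = (\<lambda>j. g (complex_of_real (1 - 1 / (real j + 2)) * \<zeta>))"
      by (auto simp: G_def fun_eq_iff)
    then have lim: "lim (\<lambda>j. G (1 - 1 / (real j + 2)) \<zeta>) = l"
      if "((\<lambda>t. g (complex_of_real t * \<zeta>)) \<longlongrightarrow> l) (at_left 1)" for l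
      using limI[OF radial_limit_tendsto_seq[OF that]] by simp
    show ?thesis
    proof (cases rule: radial_limit_cases[of g \<zeta>])
      case limit
      then have "E \<zeta>" unfolding E by blast
      then show ?thesis using lim[OF limit] by simp
    next
      case no_limit
      then have "\<not> E \<zeta>" unfolding E by blast
      then show ?thesis using no_limit(2) by simp
    qed
  qed
  then show ?thesis
    by (subst measurable_cong) measurable
qed

section \<open>From the Smirnov class to uniform integrability\<close>

text \<open>
  With \<open>|f1| \<le> B\<close> and an outer denominator of boundary modulus \<open>\<rho>\<close>, the function \<open>k = ln B - ln
  \<rho>\<close> works, constants being reproduced by the Poisson integral.
\<close>

lemma smirnov_log_majorant:
  assumes "f \<in> smirnov"
  obtains k where "integrable arc_length k"
    "\<And>z. cmod z < 1 \<Longrightarrow> cmod (f z) \<le> exp (Re (herglotz k z))"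
proof -
  obtain f1 f2 where f12: "bounded_holomorphic f1" "outer f2" "\<And>z. z \<in> unit_disk \<Longrightarrow> f z = f1 z / f2 z"
    using assms unfolding smirnov_def by blast
  obtain B where B: "B \<ge> 1" "\<And>z. cmod z < 1 \<Longrightarrow> cmod (f1 z) \<le> B"
    using bounded_holomorphicE[OF f12(1)] by metis
  obtain c \<rho> where c: "cmod c = 1" and \<rho>: "integrable arc_length (\<lambda>\<zeta>. ln (\<rho> \<zeta> :: real))"
    and f2: "\<And>z. z \<in> unit_disk \<Longrightarrow> f2 z = c * exp (herglotz (\<lambda>\<zeta>. ln (\<rho> \<zeta>)) z)"
    using f12(2) unfolding outer_def herglotz_def by blast
  define k where "k \<zeta> = ln B + - ln (\<rho> \<zeta>)" for \<zeta>
  have k: "integrable arc_length k"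
    unfolding k_def by (intro Bochner_Integration.integrable_add) (use \<rho> in auto)
  show thesis
  proof (rule that[of k])
    show "integrable arc_length k" by (rule k)
    fix z :: complex assume z: "cmod z < 1"
    let ?h = "\<lambda>\<zeta>. ln (\<rho> \<zeta>)"
    have "cmod (f z) = cmod (f1 z) * exp (- Re (herglotz ?h z))"
      using f12(3)[of z] f2[of z] z c by (simp add: norm_divide norm_mult exp_minus field_simps)
    also have "\<dots> \<le> B * exp (- Re (herglotz ?h z))"
      using B z by (intro mult_right_mono) auto
    also have "\<dots> = exp (ln B - Re (herglotz ?h z))"
      using B(1) by (simp add: exp_diff exp_minus field_simps)
    also have "ln B - Re (herglotz ?h z) = Re (herglotz k z)"
      unfolding k_def using \<rho>
      by (subst herglotz_add) (auto simp: z Re_herglotz_const[OF z] herglotz_minus)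
    finally show "cmod (f z) \<le> exp (Re (herglotz k z))" .
  qed
qed

lemma schur_class_leD:
  assumes "\<psi> \<in> schur_class_le a"
  shows "\<psi> holomorphic_on unit_disk" "\<And>z. cmod z < 1 \<Longrightarrow> cmod (\<psi> z) < 1" "cmod (\<psi> 0) \<le> a"
  using assms by (auto simp: schur_class_le_def schur_class_def image_subset_iff)

text \<open>
  \<open>H[h] \<circ> \<psi>\<close> is holomorphic, so the integral equals \<open>2 \<pi> Re H[h] (\<psi> 0)\<close> by the mean value
  property, which Harnack's inequality bounds independently of \<open>\<psi>\<close> and \<open>r\<close>.
\<close>

lemma nn_integral_Re_herglotz_compose:
  assumes \<psi>: "\<psi> \<in> schur_class_le a" and a: "a < 1"
    and h: "integrable arc_length h" and nonneg: "\<And>\<zeta>. \<zeta> \<in> unit_circle \<Longrightarrow> 0 \<le> h \<zeta>"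
    and r: "0 < r" "r < 1"
  shows "(\<integral>\<^sup>+\<zeta>. ennreal (Re (herglotz h (\<psi> (complex_of_real r * \<zeta>)))) \<partial>arc_length) \<le>
    ennreal ((1 + a) / (1 - a) * (\<integral>\<zeta>. h \<zeta> \<partial>arc_length))"
proof -
  note \<psi>D = schur_class_leD[OF \<psi>]
  let ?F = "\<lambda>z. herglotz h (\<psi> z)"
  have F_hol: "?F holomorphic_on unit_disk"
    using \<psi>D(1,2) by (intro holomorphic_on_compose_gen[OF _ herglotz_holomorphic[OF h], unfolded o_def]) auto
  have cont: "continuous_on unit_circle (\<lambda>\<zeta>. ?F (complex_of_real r * \<zeta>))"
    using r by (intro dilation_continuous_on_circle[where g = ?F] holomorphic_on_imp_continuous_on F_hol) auto
  have in_disk: "cmod (\<psi> (complex_of_real r * \<zeta>)) < 1" if "\<zeta> \<in> unit_circle" for \<zeta>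
    using that r by (intro \<psi>D(2)) (auto simp: norm_mult)
  have "Re (herglotz (\<lambda>_. 0) (\<psi> (complex_of_real r * \<zeta>))) \<le> Re (?F (complex_of_real r * \<zeta>))"
    if "\<zeta> \<in> unit_circle" for \<zeta>
    using nonneg in_disk[OF that] by (intro Re_herglotz_mono h) auto
  then have "(\<integral>\<^sup>+\<zeta>. ennreal (Re (?F (complex_of_real r * \<zeta>))) \<partial>arc_length) =
      ennreal (\<integral>\<zeta>. Re (?F (complex_of_real r * \<zeta>)) \<partial>arc_length)"
    by (intro nn_integral_eq_integral integrable_arc_length_continuous continuous_intros cont AE_I2)
       (simp add: space_arc_length herglotz_def)
  also have "(\<integral>\<zeta>. Re (?F (complex_of_real r * \<zeta>)) \<partial>arc_length) =
      Re (\<integral>\<zeta>. ?F (complex_of_real r * \<zeta>) \<partial>arc_length)"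
    by (intro integral_Re integrable_arc_length_continuous cont)
  also have "(\<integral>\<zeta>. ?F (complex_of_real r * \<zeta>) \<partial>arc_length) = 2 * pi * ?F (complex_of_real r * 0)"
    using r by (intro mean_value_arc_length[OF dilation_holomorphic[OF F_hol, of r]]) auto
  also have "Re \<dots> = 2 * pi * Re (herglotz h (\<psi> 0))"
    by simp
  also have "\<dots> \<le> (1 + a) / (1 - a) * (\<integral>\<zeta>. h \<zeta> \<partial>arc_length)"
    by (intro Re_herglotz_le h \<psi>D(3) a nonneg)
  finally show ?thesis by (simp add: ennreal_leI)
qed

text \<open>
  The coercion to \<open>ennreal\<close> truncates at 0, so the integrand is the positive part of \<open>log\<^sup>+ |(f
  \<circ> \<psi>)\<^sup>*| - n\<close>. Since \<open>k \<le> n + (k - n)\<^sup>+\<close>, the majorant gives \<open>log\<^sup>+ |f| - n \<le> Re H[(k - n)\<^sup>+]\<close>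
  on the disk; the bound passes to radial limits by Fatou's lemma. The condition on \<open>no_limit\<close>
  makes the integrand vanish where no radial limit exists.
\<close>

lemma nn_integral_log_plus_excess_le:
  fixes f :: "complex \<Rightarrow> complex"
  assumes f: "continuous_on unit_disk f"
    and k: "integrable arc_length k" 
    and le: "\<And>z. cmod z < 1 \<Longrightarrow> cmod (f z) \<le> exp (Re (herglotz k z))"
    and a: "a < 1" and \<psi>: "\<psi> \<in> schur_class_le a"
    and n: "0 \<le> n" "log_plus (cmod no_limit) \<le> n"
  shows "(\<integral>\<^sup>+\<zeta>. ennreal (log_plus (cmod (radial_limit (f \<circ> \<psi>) \<zeta>)) - n) \<partial>arc_length) \<le>
    ennreal ((1 + a) / (1 - a) * (\<integral>\<zeta>. max 0 (k \<zeta> - n) \<partial>arc_length))"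
proof -
  note \<psi>D = schur_class_leD[OF \<psi>]
  let ?h = "\<lambda>\<zeta>. max 0 (k \<zeta> - n)"
  have h: "integrable arc_length ?h"
    by (intro Bochner_Integration.integrable_max Bochner_Integration.integrable_diff k) auto
  let ?u = "\<lambda>z. Re (herglotz ?h (\<psi> z))"
  have log_le: "log_plus (cmod (f w)) - n \<le> Re (herglotz ?h w)" if w: "cmod w < 1" for w
  proof -
    have h0: "0 \<le> Re (herglotz ?h w)"
      using Re_herglotz_mono[of "\<lambda>_. 0" ?h w] h w by (simp add: herglotz_def)
    have "Re (herglotz k w) \<le> Re (herglotz (\<lambda>\<zeta>. n + ?h \<zeta>) w)"
      using h k w by (intro Re_herglotz_mono) auto
    also have "\<dots> = n + Re (herglotz ?h w)"
      using h w by (subst herglotz_add) (auto simp: Re_herglotz_const)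
    finally have "cmod (f w) \<le> exp (n + Re (herglotz ?h w))"
      using le[OF w] by (meson exp_le_cancel_iff order_trans)
    then have "ln (max 1 (cmod (f w))) \<le> ln (exp (n + Re (herglotz ?h w)))"
      using n h0 by (subst ln_le_cancel_iff) auto
    then show ?thesis by (simp add: log_plus_eq)
  qed
  define r where "r j = 1 - 1 / (real j + 2)" for j :: nat
  have r: "0 < r j" "r j < 1" for j by (auto simp: r_def)
  have in_disk: "cmod (\<psi> (complex_of_real (r j) * \<zeta>)) < 1" if "\<zeta> \<in> unit_circle" for \<zeta> j
    using that r[of j] by (intro \<psi>D(2)) (auto simp: norm_mult)
  have "continuous_on unit_disk (\<lambda>z. herglotz ?h (\<psi> z))"
    using \<psi>D(1,2)
    by (intro holomorphic_on_imp_continuous_on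
          holomorphic_on_compose_gen[OF _ herglotz_holomorphic[OF h], unfolded o_def]) auto
  then have u_cont: "continuous_on unit_circle (\<lambda>\<zeta>. ?u (complex_of_real (r j) * \<zeta>))" for j
    using r[of j] by (intro continuous_on_Re dilation_continuous_on_circle[where g = "\<lambda>z. herglotz ?h (\<psi> z)"]) auto
  have [measurable]: "(\<lambda>\<zeta>. ?u (complex_of_real (r j) * \<zeta>)) \<in> borel_measurable arc_length" for j
    by (intro borel_measurable_arc_length_continuous u_cont)
  have "(\<integral>\<^sup>+\<zeta>. ennreal (log_plus (cmod (radial_limit (f \<circ> \<psi>) \<zeta>)) - n) \<partial>arc_length) \<le>
      (\<integral>\<^sup>+\<zeta>. liminf (\<lambda>j. ennreal (?u (complex_of_real (r j) * \<zeta>))) \<partial>arc_length)"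
  proof (rule nn_integral_mono)
    fix \<zeta> assume "\<zeta> \<in> space arc_length"
    then have \<zeta>: "\<zeta> \<in> unit_circle" by (simp add: space_arc_length)
    show "ennreal (log_plus (cmod (radial_limit (f \<circ> \<psi>) \<zeta>)) - n) \<le>
        liminf (\<lambda>j. ennreal (?u (complex_of_real (r j) * \<zeta>)))"
    proof (cases rule: radial_limit_cases[of "f \<circ> \<psi>" \<zeta>])
      case no_limit
      then show ?thesis using n(2) by (simp add: ennreal_neg)
    next
      case limit
      let ?g = "\<lambda>j. log_plus (cmod (f (\<psi> (complex_of_real (r j) * \<zeta>))))"
      have "(\<lambda>j. f (\<psi> (complex_of_real (r j) * \<zeta>))) \<longlonglongrightarrow> radial_limit (f \<circ> \<psi>) \<zeta>"
        using radial_limit_tendsto_seq[OF limit] by (simp only: o_def r_def)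
      then have "?g \<longlonglongrightarrow> log_plus (cmod (radial_limit (f \<circ> \<psi>) \<zeta>))"
        by (intro continuous_on_tendsto_compose[OF continuous_on_log_plus] tendsto_norm) auto
      then have "(\<lambda>j. ennreal (?g j - n)) \<longlonglongrightarrow> ennreal (log_plus (cmod (radial_limit (f \<circ> \<psi>) \<zeta>)) - n)"
        by (intro tendsto_ennrealI tendsto_diff tendsto_const)
      from lim_imp_Liminf[OF trivial_limit_sequentially this]
      have "ennreal (log_plus (cmod (radial_limit (f \<circ> \<psi>) \<zeta>)) - n) = liminf (\<lambda>j. ennreal (?g j - n))" ..
      also have "\<dots> \<le> liminf (\<lambda>j. ennreal (?u (complex_of_real (r j) * \<zeta>)))"
        by (intro Liminf_mono always_eventually allI ennreal_leI log_le in_disk \<zeta>)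
      finally show ?thesis .
    qed
  qed
  also have "\<dots> \<le> liminf (\<lambda>j. \<integral>\<^sup>+\<zeta>. ennreal (?u (complex_of_real (r j) * \<zeta>)) \<partial>arc_length)"
    by (rule nn_integral_liminf) measurable
  also have "\<dots> \<le> liminf (\<lambda>j::nat. ennreal ((1 + a) / (1 - a) * (\<integral>\<zeta>. ?h \<zeta> \<partial>arc_length)))"
    by (intro Liminf_mono always_eventually allI nn_integral_Re_herglotz_compose \<psi> a h r) auto
  finally show ?thesis by (simp add: Liminf_const)
qed

lemma integral_excess_tendsto_0:
  assumes k: "integrable M (k :: 'a \<Rightarrow> real)" 
  shows "(\<lambda>n::nat. \<integral>x. max 0 (k x - real n) \<partial>M) \<longlonglongrightarrow> 0"
proof -
  have [measurable]: "k \<in> borel_measurable M" using k by simp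
  have "(\<lambda>n::nat. \<integral>x. max 0 (k x - real n) \<partial>M) \<longlonglongrightarrow> (\<integral>x. 0 \<partial>M)"
  proof (rule integral_dominated_convergence[where w = "\<lambda>x. \<bar>k x\<bar>"])
    show "AE x in M. (\<lambda>n. max 0 (k x - real n)) \<longlonglongrightarrow> 0"
    proof (rule AE_I2)
      fix x
      obtain N :: nat where "k x \<le> real N" using real_arch_simple by blast
      then have "eventually (\<lambda>n. max 0 (k x - real n) = 0) sequentially"
        by (intro eventually_mono[OF eventually_ge_at_top[of N]]) auto
      then show "(\<lambda>n. max 0 (k x - real n)) \<longlonglongrightarrow> 0" by (rule tendsto_eventually)
    qed
  qed (use k in auto)
  then show ?thesis by simp
qed

text \<open>
  Where \<open>g \<ge> 2 n\<close>, one has \<open>g \<le> 2 (g - n)\<close>, so the tail integrals beyond \<open>2 n\<close> are at most twice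
  the excess over \<open>n\<close>, for all \<open>\<psi>\<close> at once.
\<close>

lemma uniformly_integrable_if_smirnov:
  assumes f: "f \<in> smirnov" and a: "0 \<le> a" "a < 1"
  shows "uniformly_integrable arc_length
      {(\<lambda>\<zeta>. log_plus (cmod (radial_limit (f \<circ> \<psi>) \<zeta>))) | \<psi>. \<psi> \<in> schur_class_le a}"
proof -
  have f_cont: "continuous_on unit_disk f"
    using f by (intro holomorphic_on_imp_continuous_on nevanlinna_imp_holomorphic) (simp add: smirnov_def)
  obtain k where k: "integrable arc_length k" 
    and le: "\<And>z. cmod z < 1 \<Longrightarrow> cmod (f z) \<le> exp (Re (herglotz k z))"
    using smirnov_log_majorant[OF f] by metis
  let ?g = "\<lambda>\<psi> \<zeta>. log_plus (cmod (radial_limit (f \<circ> \<psi>) \<zeta>))"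
  have meas: "?g \<psi> \<in> borel_measurable arc_length" if "\<psi> \<in> schur_class_le a" for \<psi>
  proof -
    note \<psi>D = schur_class_leD[OF that]
    have [measurable]: "radial_limit (f \<circ> \<psi>) \<in> borel_measurable arc_length"
      using \<psi>D(1,2)
      by (intro radial_limit_measurable continuous_on_compose holomorphic_on_imp_continuous_on
            continuous_on_subset[OF f_cont]) auto
    show ?thesis unfolding log_plus_def by measurable
  qed
  define C where "C = (1 + a) / (1 - a)"
  have C: "C > 0" using a by (simp add: C_def)
  define tail where "tail t = (SUP g\<in>{?g \<psi> | \<psi>. \<psi> \<in> schur_class_le a}.
      \<integral>\<^sup>+\<zeta>\<in>{\<zeta> \<in> space arc_length. norm (g \<zeta>) \<ge> t}. ennreal (norm (g \<zeta>)) \<partial>arc_length)" for t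
  have tail_le: "tail t \<le> ennreal (2 * (C * (\<integral>\<zeta>. max 0 (k \<zeta> - n) \<partial>arc_length)))"
    if n: "0 \<le> n" "log_plus (cmod no_limit) \<le> n" and t: "t \<ge> 2 * n" for n t
    unfolding tail_def
  proof (rule SUP_least)
    fix g assume "g \<in> {?g \<psi> | \<psi>. \<psi> \<in> schur_class_le a}"
    then obtain \<psi> where \<psi>: "\<psi> \<in> schur_class_le a" and g: "g = ?g \<psi>" by blast
    have [measurable]: "g \<in> borel_measurable arc_length" unfolding g by (rule meas[OF \<psi>])
    have "(\<integral>\<^sup>+\<zeta>\<in>{\<zeta> \<in> space arc_length. norm (g \<zeta>) \<ge> t}. ennreal (norm (g \<zeta>)) \<partial>arc_length) \<le>
        (\<integral>\<^sup>+\<zeta>. 2 * ennreal (g \<zeta> - n) \<partial>arc_length)"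
    proof (rule nn_integral_mono)
      fix \<zeta>
      have "g \<zeta> \<ge> 0" by (simp add: g log_plus_nonneg)
      show "ennreal (norm (g \<zeta>)) * indicator {\<zeta> \<in> space arc_length. norm (g \<zeta>) \<ge> t} \<zeta> \<le> 2 * ennreal (g \<zeta> - n)"
      proof (cases "t \<le> g \<zeta>")
        case True
        then have "ennreal (norm (g \<zeta>)) \<le> ennreal 2 * ennreal (g \<zeta> - n)"
          using t n \<open>g \<zeta> \<ge> 0\<close> by (subst ennreal_mult[symmetric]) (auto intro!: ennreal_leI)
        then show ?thesis by (simp add: indicator_def)
      next
        case False
        then show ?thesis using \<open>g \<zeta> \<ge> 0\<close> by simp
      qed
    qed
    also have "\<dots> = 2 * (\<integral>\<^sup>+\<zeta>. ennreal (g \<zeta> - n) \<partial>arc_length)"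
      by (rule nn_integral_cmult) measurable
    also have "\<dots> \<le> 2 * ennreal (C * (\<integral>\<zeta>. max 0 (k \<zeta> - n) \<partial>arc_length))"
      unfolding g C_def by (intro mult_left_mono nn_integral_log_plus_excess_le f_cont k le a \<psi> n) auto
    also have "\<dots> = ennreal (2 * (C * (\<integral>\<zeta>. max 0 (k \<zeta> - n) \<partial>arc_length)))"
      using C by (simp add: ennreal_mult Bochner_Integration.integral_nonneg)
    finally show "(\<integral>\<^sup>+\<zeta>\<in>{\<zeta> \<in> space arc_length. norm (g \<zeta>) \<ge> t}. ennreal (norm (g \<zeta>)) \<partial>arc_length) \<le>
      ennreal (2 * (C * (\<integral>\<zeta>. max 0 (k \<zeta> - n) \<partial>arc_length)))" .
  qed
  have "(tail \<longlongrightarrow> 0) at_top"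
  proof (rule order_tendstoI)
    fix e :: ennreal assume "0 < e"
    have "(\<lambda>n::nat. ennreal (2 * (C * (\<integral>\<zeta>. max 0 (k \<zeta> - real n) \<partial>arc_length)))) \<longlonglongrightarrow> ennreal (2 * (C * 0))"
      by (intro tendsto_intros integral_excess_tendsto_0 k)
    then have "eventually (\<lambda>n::nat. ennreal (2 * (C * (\<integral>\<zeta>. max 0 (k \<zeta> - real n) \<partial>arc_length))) < e) sequentially"
      by (rule order_tendstoD) (use \<open>0 < e\<close> in simp)
    moreover have "eventually (\<lambda>n::nat. log_plus (cmod no_limit) \<le> real n) sequentially"
      by real_asymp
    ultimately have "eventually (\<lambda>n::nat. ennreal (2 * (C * (\<integral>\<zeta>. max 0 (k \<zeta> - real n) \<partial>arc_length))) < e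
        \<and> log_plus (cmod no_limit) \<le> real n) sequentially"
      by (rule eventually_conj)
    from eventually_happens'[OF trivial_limit_sequentially this]
    obtain n :: nat where n: "ennreal (2 * (C * (\<integral>\<zeta>. max 0 (k \<zeta> - real n) \<partial>arc_length))) < e"
      "log_plus (cmod no_limit) \<le> real n" by (elim exE conjE)
    show "eventually (\<lambda>t. tail t < e) at_top"
      using eventually_ge_at_top[of "2 * real n"]
    proof eventually_elim
      case (elim t)
      have "tail t \<le> ennreal (2 * (C * (\<integral>\<zeta>. max 0 (k \<zeta> - real n) \<partial>arc_length)))"
        using n(2) elim by (intro tail_le) auto
      then show ?case using n(1) by (rule le_less_trans)
    qed
  qed simp
  then show ?thesis
    unfolding uniformly_integrable_def tail_def[abs_def] using meas by (intro conjI) (blast, assumption)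
qed

theorem theorem1:
  fixes f :: "complex \<Rightarrow> complex" and a :: real
  assumes "f \<in> nevanlinna"
    and "0 \<le> a" and "a < 1"
  shows "f \<in> smirnov \<longleftrightarrow>
    uniformly_integrable arc_length
      {(\<lambda>\<zeta>. log_plus (cmod (radial_limit (f \<circ> \<psi>) \<zeta>))) | \<psi>. \<psi> \<in> schur_class_le a}"
  using smirnov_if_uniformly_integrable[OF assms(1,2)] uniformly_integrable_if_smirnov[OF _ assms(2,3)]
  by (rule iffI[rotated])

end
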